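(* Let $g\in H(\mathbb{D})$ be univalent and let $0\le\alpha<1$. Then the Volterra operator $T_g\colon H^\infty_{v_\alpha}\to H^\infty$ is compact if and only if $$\lim_{t\to1^-}\ \sup_{0\le\theta<2\pi}\int_t^1\frac{|g'(re^{i\theta})|}{(1-r^2)^\alpha}\,dr=0 .$$
   Context: $\mathbb{D}$ is the open unit disc in $\mathbb{C}$ and $H(\mathbb{D})$ is the space of analytic functions on $\mathbb{D}$. For $g\in H(\mathbb{D})$ the classical Volterra operator is $T_g(f)(z)=\int_0^z f(\xi)g'(\xi)\,d\xi$, $z\in\mathbb{D}$, $f\in H(\mathbb{D})$. $H^\infty$ is the space of bounded analytic functions on $\mathbb{D}$ with the supremum norm. For $\alpha\ge 0$, $v_\alpha(z)=(1-|z|^2)^\alpha$ and $H^\infty_{v_\alpha}=\{f\in H(\mathbb{D}):\|f\|_{H^\infty_{v_\alpha}}=\sup_{z\in\mathbb{D}}(1-|z|^2)^\alpha|f(z)|<\infty\}$; for $\alpha=0$ this is $H^\infty$. Univalent means injective on $\mathbb{D}$. "$T_g\colon X\to Y$ is compact" means that $T_g$ maps $X$ into $Y$ and is a compact linear operator. *)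

theory Defs
  imports "HOL-Complex_Analysis.Complex_Analysis"
begin

abbreviation unit_disc :: "complex set" (\<open>\<D>\<close>)
  where "\<D> \<equiv> ball 0 1"

(* An element of H(D) is represented by the total function that vanishes off the disc, so
   that equality of functions is equality on the disc and the seminorms below are norms. *)
definition hol_disc :: "(complex \<Rightarrow> complex) set"
  where "hol_disc = {f. f holomorphic_on \<D> \<and> (\<forall>z. z \<notin> \<D> \<longrightarrow> f z = 0)}"

definition Hinf :: "(complex \<Rightarrow> complex) set"
  where "Hinf = {f \<in> hol_disc. bounded (f ` \<D>)}"

definition Hinf_norm :: "(complex \<Rightarrow> complex) \<Rightarrow> real"
  where "Hinf_norm f = (SUP z\<in>\<D>. norm (f z))"

(* The base 1 - |z|^2 is positive on the disc, so powr is the ordinary power there,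
   also for exponent 0. *)
definition std_weight :: "real \<Rightarrow> complex \<Rightarrow> real"
  where "std_weight \<alpha> z = (1 - (norm z)\<^sup>2) powr \<alpha>"

definition Hinf_weighted :: "real \<Rightarrow> (complex \<Rightarrow> complex) set"
  where "Hinf_weighted \<alpha> = {f \<in> hol_disc. bdd_above ((\<lambda>z. std_weight \<alpha> z * norm (f z)) ` \<D>)}"

definition Hinf_weighted_norm :: "real \<Rightarrow> (complex \<Rightarrow> complex) \<Rightarrow> real"
  where "Hinf_weighted_norm \<alpha> f = (SUP z\<in>\<D>. std_weight \<alpha> z * norm (f z))"

definition volterra :: "(complex \<Rightarrow> complex) \<Rightarrow> (complex \<Rightarrow> complex) \<Rightarrow> complex \<Rightarrow> complex"
  where "volterra g f z =
    (if z \<in> \<D> then contour_integral (linepath 0 z) (\<lambda>\<xi>. f \<xi> * deriv g \<xi>) else 0)"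

(* Totalised by 0 off Y, because Metric_space requires nonnegativity and symmetry for all
   arguments and the supremum of an unbounded set of reals is unspecified. *)
definition norm_dist ::
    "('a \<Rightarrow> complex) set \<Rightarrow> (('a \<Rightarrow> complex) \<Rightarrow> real) \<Rightarrow> ('a \<Rightarrow> complex) \<Rightarrow> ('a \<Rightarrow> complex) \<Rightarrow> real"
  where "norm_dist Y nY f h = (if f \<in> Y \<and> h \<in> Y then nY (\<lambda>z. f z - h z) else 0)"

definition norm_topology ::
    "('a \<Rightarrow> complex) set \<Rightarrow> (('a \<Rightarrow> complex) \<Rightarrow> real) \<Rightarrow> ('a \<Rightarrow> complex) topology"
  where "norm_topology Y nY = Metric_space.mtopology Y (norm_dist Y nY)"

definition linear_map_on ::
    "('a \<Rightarrow> complex) set \<Rightarrow> (('a \<Rightarrow> complex) \<Rightarrow> ('a \<Rightarrow> complex)) \<Rightarrow> bool"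
  where "linear_map_on X T \<longleftrightarrow>
    (\<forall>f\<in>X. \<forall>h\<in>X. \<forall>a b. T (\<lambda>z. a * f z + b * h z) = (\<lambda>z. a * T f z + b * T h z))"

(* T is a linear map of the normed function space (X, nX) into (Y, nY) which sends the closed
   unit ball to a relatively compact set. *)
definition compact_operator ::
    "('a \<Rightarrow> complex) set \<Rightarrow> (('a \<Rightarrow> complex) \<Rightarrow> real) \<Rightarrow>
     ('a \<Rightarrow> complex) set \<Rightarrow> (('a \<Rightarrow> complex) \<Rightarrow> real) \<Rightarrow>
     (('a \<Rightarrow> complex) \<Rightarrow> ('a \<Rightarrow> complex)) \<Rightarrow> bool"
  where "compact_operator X nX Y nY T \<longleftrightarrow>
    T ` X \<subseteq> Y \<and> linear_map_on X T \<and>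
    compactin (norm_topology Y nY) (norm_topology Y nY closure_of (T ` {f \<in> X. nX f \<le> 1}))"

lemma std_weight_pos: "z \<in> \<D> \<Longrightarrow> std_weight \<alpha> z > 0"
  using abs_square_eq_1[of "norm z"] by (simp add: std_weight_def)

lemma std_weight_0: "z \<in> \<D> \<Longrightarrow> std_weight 0 z = 1"
  using abs_square_eq_1[of "norm z"] by (simp add: std_weight_def)

lemma Hinf_weighted_0: "Hinf_weighted 0 = Hinf"
proof -
  have "bdd_above ((\<lambda>z. std_weight 0 z * norm (f z)) ` \<D>) \<longleftrightarrow> bounded (f ` \<D>)"
    for f :: "complex \<Rightarrow> complex"
    by (simp add: bdd_above_def bounded_iff std_weight_0 del: mem_ball)
  then show ?thesis by (simp add: Hinf_weighted_def Hinf_def)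
qed

lemma Hinf_weighted_norm_0: "Hinf_weighted_norm 0 f = Hinf_norm f"
  unfolding Hinf_weighted_norm_def Hinf_norm_def by (intro SUP_cong) (auto simp: std_weight_0)

lemma Metric_space_Hinf_weighted:
  "Metric_space (Hinf_weighted \<alpha>) (norm_dist (Hinf_weighted \<alpha>) (Hinf_weighted_norm \<alpha>))"
proof -
  define w where "w = std_weight \<alpha>"
  have wpos: "w z > 0" if "z \<in> \<D>" for z using std_weight_pos that unfolding w_def by blast
  have bdd: "bdd_above ((\<lambda>z. w z * norm (f z - h z)) ` \<D>)"
    if fh: "f \<in> Hinf_weighted \<alpha>" "h \<in> Hinf_weighted \<alpha>" for f h
  proof -
    obtain A B where A: "\<And>z. z \<in> \<D> \<Longrightarrow> w z * norm (f z) \<le> A"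
      and B: "\<And>z. z \<in> \<D> \<Longrightarrow> w z * norm (h z) \<le> B"
      using fh unfolding Hinf_weighted_def w_def bdd_above_def by blast
    have "w z * norm (f z - h z) \<le> A + B" if "z \<in> \<D>" for z
    proof -
      have "w z * norm (f z - h z) \<le> w z * (norm (f z) + norm (h z))"
        using wpos[OF that] by (intro mult_left_mono norm_triangle_ineq4) auto
      then show ?thesis using A[OF that] B[OF that] by (simp add: algebra_simps)
    qed
    then show ?thesis by (intro bdd_aboveI2) blast
  qed
  have le: "w z * norm (f z - h z) \<le> Hinf_weighted_norm \<alpha> (\<lambda>z. f z - h z)"
    if "f \<in> Hinf_weighted \<alpha>" "h \<in> Hinf_weighted \<alpha>" "z \<in> \<D>" for f h z
    unfolding Hinf_weighted_norm_def w_def[symmetric]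
    by (intro cSUP_upper[OF that(3)] bdd that)
  have ge0: "0 \<le> Hinf_weighted_norm \<alpha> (\<lambda>z. f z - h z)"
    if "f \<in> Hinf_weighted \<alpha>" "h \<in> Hinf_weighted \<alpha>" for f h
  proof -
    have "0 \<le> w 0 * norm (f 0 - h 0)" using wpos[of 0] by simp
    also have "\<dots> \<le> Hinf_weighted_norm \<alpha> (\<lambda>z. f z - h z)" by (intro le that) simp
    finally show ?thesis .
  qed
  have eq: "f = h" if fh: "f \<in> Hinf_weighted \<alpha>" "h \<in> Hinf_weighted \<alpha>"
    and 0: "Hinf_weighted_norm \<alpha> (\<lambda>z. f z - h z) = 0" for f h
  proof
    fix z
    show "f z = h z"
    proof (cases "z \<in> \<D>")
      case True
      then have "w z * norm (f z - h z) \<le> 0" using le[OF fh True] 0 by simp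
      then show ?thesis using wpos[OF True] by (simp add: mult_le_0_iff)
    next
      case False
      then show ?thesis using fh by (simp add: Hinf_weighted_def hol_disc_def)
    qed
  qed
  have refl: "Hinf_weighted_norm \<alpha> (\<lambda>z. f z - f z) = 0" for f
    by (simp add: Hinf_weighted_norm_def)
  have tri: "Hinf_weighted_norm \<alpha> (\<lambda>z. f z - k z)
      \<le> Hinf_weighted_norm \<alpha> (\<lambda>z. f z - h z) + Hinf_weighted_norm \<alpha> (\<lambda>z. h z - k z)"
    if "f \<in> Hinf_weighted \<alpha>" "h \<in> Hinf_weighted \<alpha>" "k \<in> Hinf_weighted \<alpha>" for f h k
    unfolding Hinf_weighted_norm_def[of \<alpha> "\<lambda>z. f z - k z"] w_def[symmetric]
  proof (intro cSUP_least)
    fix z assume z: "z \<in> \<D>"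
    have "norm (f z - k z) \<le> norm (f z - h z) + norm (h z - k z)"
      using norm_triangle_ineq[of "f z - h z" "h z - k z"] by simp
    then have "w z * norm (f z - k z) \<le> w z * norm (f z - h z) + w z * norm (h z - k z)"
      using wpos[OF z] by (simp flip: distrib_left)
    then show "w z * norm (f z - k z)
        \<le> Hinf_weighted_norm \<alpha> (\<lambda>z. f z - h z) + Hinf_weighted_norm \<alpha> (\<lambda>z. h z - k z)"
      using le[OF that(1,2) z] le[OF that(2,3) z] by linarith
  qed simp
  have sym: "Hinf_weighted_norm \<alpha> (\<lambda>z. f z - h z) = Hinf_weighted_norm \<alpha> (\<lambda>z. h z - f z)" for f h
    by (simp add: Hinf_weighted_norm_def norm_minus_commute)
  show ?thesis
    by unfold_locales (use ge0 eq refl tri sym in \<open>auto simp: norm_dist_def\<close>)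
qed

lemma Metric_space_Hinf: "Metric_space Hinf (norm_dist Hinf Hinf_norm)"
proof -
  have "Hinf_weighted_norm 0 = Hinf_norm" by (rule ext) (rule Hinf_weighted_norm_0)
  then show ?thesis using Metric_space_Hinf_weighted[of 0] by (simp add: Hinf_weighted_0)
qed

end

theory Submission
  imports Defs
begin

text \<open>
  On a radius with direction \<open>e = exp (\<i> \<theta>)\<close> the function \<open>T\<^sub>g f\<close> is a primitive of
  \<open>r \<mapsto> f (r e) g' (r e) e\<close>. For \<open>f\<close> in the unit ball of the weighted space its variation over
  \<open>t < r < 1\<close> is therefore at most the tail of the radial integral of
  \<open>\<bar>g'\<bar> / (1 - r\<^sup>2) powr \<alpha>\<close>. If these tails are uniformly small, \<open>T\<^sub>g f\<close> is controlled, up to a small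
  error, by its values on a smaller closed disc, where it depends only on the values of \<open>f\<close> there; a
  normal families argument then shows that the image of the unit ball is compact.

  Conversely, a compact \<open>T\<^sub>g\<close> sends the functions \<open>z ^ m f(z)\<close>, with \<open>f\<close> in the unit ball, to functions
  that are uniformly small for large \<open>m\<close>. To turn this into smallness of an integral of
  \<open>\<bar>g'\<bar>\<close> one needs, for each radius, some \<open>f\<close> in a fixed multiple of the unit ball that cancels the
  phase of \<open>g'\<close> there: the real part of \<open>f g' e\<close> has to dominate the radial integrand. The
  factor \<open>(1 - (z / e)\<^sup>2) powr (- \<alpha>)\<close> supplies the weight, so a bounded analytic function \<open>exp (- \<i> F)\<close>
  is needed such that \<open>F\<close> is real on the radius, stays within distance \<open>1 < \<pi> / 2\<close> of \<open>arg (g' e)\<close> there, and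
  has bounded imaginary part on the whole disc.

  Univalence is what makes such an \<open>F\<close> exist. It bounds \<open>(1 - \<bar>z\<bar>) \<bar>g''(z) / g'(z)\<bar>\<close> by an absolute
  constant (lemma \<open>univalent_pre_schwarzian_bound\<close>), which means that \<open>arg g'\<close> is Lipschitz in the hyperbolic
  coordinate \<open>x = ln ((1 + r) / (1 - r))\<close>. In this coordinate the disc is the strip
  \<open>\<bar>Im\<bar> < \<pi> / 2\<close> and the radius is the positive real axis. Convolving a function that is Lipschitz on the line
  with a narrow Gaussian moves it only a little, and the result is entire; its derivative is
  a convolution of a bounded function with a Gaussian, hence bounded on the strip, so that
  its imaginary part is bounded there (lemma \<open>holomorphic_approximation_of_phase\<close>). The narrower the Gaussian, the better the
  approximation and the larger the bound, but the width, and with it the bound, can be chosen in terms of the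
  Lipschitz constant alone. So the bound is the same for all directions and for all segments of a radius,
  and it suffices to treat segments that end before the unit circle.
\<close>

section \<open>The pre-Schwarzian derivative of a univalent function\<close>

text \<open>
  If the image covered the disc of radius 2, the inverse function, precomposed with \<open>z \<mapsto> 2 z\<close>, would map the
  unit disc into itself, fix 0 and have derivative 2 there, against Schwarz's lemma.
\<close>
lemma univalent_normalised_omits_point:
  assumes h: "h holomorphic_on \<D>" "inj_on h \<D>" and "h 0 = 0" "deriv h 0 = 1"
  obtains w where "w \<notin> h ` \<D>" "norm w < 2"
proof -
  have False if sub: "ball 0 2 \<subseteq> h ` \<D>"
  proof -
    obtain k where k: "k holomorphic_on h ` \<D>" 
      "\<And>z. z \<in> \<D> \<Longrightarrow> deriv h z * deriv k (h z) = 1" "\<And>z. z \<in> \<D> \<Longrightarrow> k (h z) = z"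
      using holomorphic_has_inverse[OF h(1) _ h(2)] by auto
    have kD: "k w \<in> \<D>" if "w \<in> h ` \<D>" for w using k(3) that by fastforce
    have k0: "k 0 = 0" using k(3)[of 0] assms by simp
    have dk: "deriv k 0 = 1" using k(2)[of 0] assms by simp
    have holk: "k holomorphic_on ball 0 2" using k(1) sub holomorphic_on_subset by blast
    define q where "q = (\<lambda>z. k (2 * z))"
    have holq: "q holomorphic_on \<D>" 
      unfolding q_def using holk 
      by (intro holomorphic_on_compose_gen[of "\<lambda>z. 2 * z" _ k "ball 0 2", unfolded o_def])
        (auto intro!: holomorphic_intros simp: norm_mult)
    have "(k has_field_derivative 1) (at 0)"
      using holomorphic_derivI[OF holk, of 0] dk by auto
    then have "(q has_field_derivative 2) (at 0)"
      unfolding q_def using DERIV_cmult_Id[of "2::complex" 0 UNIV]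
      by (intro DERIV_chain2[where f = k and g = "\<lambda>z. 2 * z" and Da = 1 and Db = 2, simplified]) auto
    then have "deriv q 0 = 2" by (rule DERIV_imp_deriv)
    moreover have "norm (deriv q 0) \<le> 1"
    proof (rule Schwarz_Lemma(2)[where \<xi> = 0, OF holq])
      show "q 0 = 0" by (simp add: q_def k0)
      show "norm (q z) < 1" if "norm z < 1" for z
      proof -
        have "2 * z \<in> ball 0 2" using that by (simp add: norm_mult)
        then have "k (2 * z) \<in> \<D>" using kD sub by blast
        then show ?thesis by (simp add: q_def)
      qed
    qed simp_all
    ultimately show False by simp
  qed
  then show ?thesis using that by (force simp: subset_iff)
qed

text \<open>
  A weak form of Bieberbach's inequality, with a constant that comes from Schottky's theorem. If \<open>h\<close> omits \<open>w\<close>, then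
  \<open>G = sqrt (1 - h / w)\<close> is analytic. It omits 0, and it also omits \<open>- G 0\<close>, because \<open>h\<close> vanishes only at 0.
  So \<open>- G / G 0\<close> omits 0 and 1, and Schottky's theorem bounds \<open>G\<close>, hence \<open>h\<close>, near 0.
\<close>
lemma univalent_normalised_coeff_bound:
  obtains C where "C > 0"
    "\<And>h. \<lbrakk>h holomorphic_on \<D>; inj_on h \<D>; h 0 = 0; deriv h 0 = 1\<rbrakk> \<Longrightarrow> norm (deriv (deriv h) 0) \<le> C"
proof -
  define M where "M = exp (pi * exp (pi * (2 + 2 * 1 + 12 * (1/2) / (1 - 1/2))))"
  have "norm (deriv (deriv h) 0) \<le> 64 * (1 + M\<^sup>2)"
    if h: "h holomorphic_on \<D>" "inj_on h \<D>" "h 0 = 0" "deriv h 0 = 1" for h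
  proof -
    obtain w where w: "w \<notin> h ` \<D>" "norm w < 2"
      using univalent_normalised_omits_point[OF h] .
    have "w \<noteq> 0" using w(1) h(3) by force
    define k where "k = (\<lambda>z. 1 - h z / w)"
    have holk: "k holomorphic_on \<D>" unfolding k_def using h(1) \<open>w \<noteq> 0\<close> 
      by (intro holomorphic_intros) auto
    have "k z \<noteq> 0" if "z \<in> \<D>" for z
      using w(1) that \<open>w \<noteq> 0\<close> by (auto simp: k_def)
    then obtain G where G: "G holomorphic_on \<D>" "\<And>z. z \<in> \<D> \<Longrightarrow> k z = G z ^ 2"
      using contractible_imp_holomorphic_sqrt[OF holk convex_imp_contractible[OF convex_ball]] by metis
    have Gnz: "G z \<noteq> 0" if "z \<in> \<D>" for z using \<open>\<And>z. z \<in> \<D> \<Longrightarrow> k z \<noteq> 0\<close>[OF that] G(2)[OF that] by auto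
    have "(G 0)\<^sup>2 = 1" using G(2)[of 0] h(3) by (simp add: k_def)
    \<comment> \<open>The two square roots of \<open>k\<close> take opposite values; the value \<open>G z = - G 0\<close> would force
      \<open>h z = 0\<close>, hence \<open>z = 0\<close>.\<close>
    define q where "q = (\<lambda>z. - (G (z / 2) / G 0))"
    have qe: "z = 0" if "z \<in> cball 0 1" "G (z / 2) = - G 0" for z
    proof -
      have z: "z / 2 \<in> \<D>" using that(1) by (simp add: norm_divide)
      have "k (z / 2) = 1" using that(2) G(2)[OF z] \<open>(G 0)\<^sup>2 = 1\<close> by simp
      then have "h (z / 2) = h 0" using \<open>w \<noteq> 0\<close> h(3) by (simp add: k_def)
      then show ?thesis using inj_onD[OF h(2), of "z/2" 0] z by simp
    qed
    have G0: "G 0 \<noteq> 0" using \<open>(G 0)\<^sup>2 = 1\<close> by auto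
    have nG0: "norm (G 0) = 1" using \<open>(G 0)\<^sup>2 = 1\<close> 
      by (metis norm_ge_zero norm_one norm_power power2_eq_1_iff abs_of_nonneg abs_1 abs_minus_cancel real_sqrt_abs real_sqrt_one)
    have bnd: "norm (q z) \<le> M" if "norm z \<le> 1 / 2" for z
      unfolding M_def
    proof (rule Schottky[OF _ _ _ _ _ that])
      show "q holomorphic_on cball 0 1"
        unfolding q_def using G(1) G0
        by (intro holomorphic_intros holomorphic_on_compose_gen[of "\<lambda>z. z / 2" _ G \<D>, unfolded o_def])
          (auto simp: norm_divide)
      show "\<not> (q z = 0 \<or> q z = 1)" if "z \<in> cball 0 1" for z
      proof -
        have "z / 2 \<in> \<D>" using that by (simp add: norm_divide)
        then have "q z \<noteq> 0" using Gnz G0 by (simp add: q_def)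
        moreover have "q z \<noteq> 1"
        proof
          assume "q z = 1"
          then have "- G (z / 2) = G 0" using G0 by (simp add: q_def field_simps)
          then have *: "G (z / 2) = - G 0" by (simp flip: minus_equation_iff)
          then have "z = 0" using qe that by blast
          with * G0 show False by simp
        qed
        ultimately show ?thesis by blast
      qed
      show "norm (q 0) \<le> 1" using G0 by (simp add: q_def)
    qed auto
    have hb: "norm (h z) \<le> 2 * (1 + M\<^sup>2)" if "norm z \<le> 1 / 4" for z
    proof -
      have z: "z \<in> \<D>" using that by simp
      have "norm (q (2 * z)) \<le> M" using bnd[of "2 * z"] that by (simp add: norm_mult)
      then have "norm (G z) \<le> M" by (simp add: q_def norm_divide nG0)
      then have "norm (G z ^ 2) \<le> M\<^sup>2" by (simp add: norm_power power_mono)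
      then have "norm (1 - G z ^ 2) \<le> 1 + M\<^sup>2"
        using norm_triangle_ineq4[of 1 "G z ^ 2"] by simp
      moreover have "h z = w * (1 - G z ^ 2)" using G(2)[OF z] \<open>w \<noteq> 0\<close> by (simp add: k_def field_simps)
      moreover have "norm w \<le> 2" using w(2) by simp
      ultimately show ?thesis using mult_mono[of "norm w" 2 "norm (1 - G z ^ 2)" "1 + M\<^sup>2"]
        by (simp add: norm_mult)
    qed
    have "norm ((deriv ^^ 2) h 0) \<le> fact 2 * (2 * (1 + M\<^sup>2)) / (1 / 4) ^ 2"
    proof (rule Cauchy_inequality)
      show "h holomorphic_on ball 0 (1 / 4)" using h(1) by (rule holomorphic_on_subset) auto
      show "continuous_on (cball 0 (1 / 4)) h"
        using holomorphic_on_imp_continuous_on[OF h(1)] by (rule continuous_on_subset) auto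
    qed (use hb in auto)
    then show ?thesis by (simp add: numeral_2_eq_2)
  qed
  moreover have "64 * (1 + M\<^sup>2) > 0" by (simp add: add_pos_nonneg)
  ultimately show ?thesis using that by blast
qed

text \<open>
  The bound at 0 is transported to \<open>a\<close> by an affine map of the unit disc onto the disc of radius
  \<open>1 - norm a\<close> about \<open>a\<close>.
\<close>
lemma univalent_pre_schwarzian_bound:
  obtains C where "C > 0"
    "\<And>f a. \<lbrakk>f holomorphic_on \<D>; inj_on f \<D>; a \<in> \<D>\<rbrakk>
      \<Longrightarrow> norm (deriv (deriv f) a / deriv f a) \<le> C / (1 - norm a)"
proof -
  obtain C where C: "C > 0" and bound:
    "\<And>h. \<lbrakk>h holomorphic_on \<D>; inj_on h \<D>; h 0 = 0; deriv h 0 = 1\<rbrakk> \<Longrightarrow> norm (deriv (deriv h) 0) \<le> C"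
    using univalent_normalised_coeff_bound by blast
  have "norm (deriv (deriv f) a / deriv f a) \<le> C / (1 - norm a)"
    if f: "f holomorphic_on \<D>" "inj_on f \<D>" and a: "a \<in> \<D>" for f and a :: complex
  proof -
    define \<rho> where "\<rho> = 1 - norm a"
    have \<rho>: "\<rho> > 0" using a by (simp add: \<rho>_def)
    have df: "deriv f a \<noteq> 0" using holomorphic_injective_imp_regular[OF f(1) _ f(2) a] by simp
    define h where "h = (\<lambda>z. (f (a + of_real \<rho> * z) - f a) / (of_real \<rho> * deriv f a))"
    have inD: "a + of_real \<rho> * z \<in> \<D>" if "z \<in> \<D>" for z
    proof -
      have "norm (a + of_real \<rho> * z) \<le> norm a + \<rho> * norm z"
        using norm_triangle_ineq[of a "\<rho> * z"] \<rho> by (simp add: norm_mult)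
      also have "\<dots> < norm a + \<rho> * 1" using \<rho> that by (intro add_strict_left_mono mult_strict_left_mono) auto
      finally show ?thesis by (simp add: \<rho>_def)
    qed
    have dh: "(h has_field_derivative deriv f (a + of_real \<rho> * z) / deriv f a) (at z)" if "z \<in> \<D>" for z
    proof -
      have 1: "(f has_field_derivative deriv f (a + of_real \<rho> * z)) (at (a + of_real \<rho> * z))"
        using holomorphic_derivI[OF f(1) _ inD[OF that]] by simp
      have 2: "((\<lambda>z. a + of_real \<rho> * z) has_field_derivative of_real \<rho>) (at z)"
        by (auto intro!: derivative_eq_intros)
      show ?thesis unfolding h_def using \<rho> df
        by (auto intro!: derivative_eq_intros DERIV_chain2[OF 1 2])
    qed
    have holh: "h holomorphic_on \<D>" using dh 
      by (meson holomorphic_onI field_differentiable_at_within field_differentiable_def)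
    have derh: "deriv h z = deriv f (a + of_real \<rho> * z) / deriv f a" if "z \<in> \<D>" for z
      using dh[OF that] by (rule DERIV_imp_deriv)
    have injh: "inj_on h \<D>"
    proof (rule inj_onI)
      fix x y assume xy: "x \<in> \<D>" "y \<in> \<D>" "h x = h y"
      then have "f (a + of_real \<rho> * x) = f (a + of_real \<rho> * y)" using \<rho> df by (simp add: h_def)
      then have "a + of_real \<rho> * x = a + of_real \<rho> * y" using inD xy f(2) by (meson inj_onD)
      then show "x = y" using \<rho> by simp
    qed
    have "deriv (deriv h) 0 = of_real \<rho> * deriv (deriv f) a / deriv f a"
    proof -
      have "((\<lambda>z. deriv f (a + of_real \<rho> * z) / deriv f a) has_field_derivative of_real \<rho> * deriv (deriv f) a / deriv f a) (at 0)"
      proof -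
        have 1: "(deriv f has_field_derivative deriv (deriv f) a) (at (a + of_real \<rho> * 0))"
          using holomorphic_derivI[OF holomorphic_deriv[OF f(1)] _ a] by simp
        have 2: "((\<lambda>z. a + of_real \<rho> * z) has_field_derivative of_real \<rho>) (at 0)"
          by (auto intro!: derivative_eq_intros)
        show ?thesis using df
          by (auto intro!: derivative_eq_intros DERIV_chain2[OF 1 2])
      qed
      then have "(deriv h has_field_derivative of_real \<rho> * deriv (deriv f) a / deriv f a) (at 0)"
        by (rule has_field_derivative_transform_within_open[where S = \<D>]) (auto simp: derh)
      then show ?thesis by (rule DERIV_imp_deriv)
    qed
    moreover have "norm (deriv (deriv h) 0) \<le> C"
      by (rule bound[OF holh injh]) (use derh[of 0] df in \<open>auto simp: h_def\<close>)
    ultimately have "\<rho> * norm (deriv (deriv f) a / deriv f a) \<le> C" using \<rho>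
      by (simp add: norm_mult norm_divide)
    then show ?thesis using \<rho> unfolding \<rho>_def[symmetric] by (simp add: pos_le_divide_eq mult.commute)
  qed
  with C that show ?thesis by blast
qed

section \<open>An entire approximation of the unit step\<close>

lemma entire_gaussian_primitive:
  obtains E :: "complex \<Rightarrow> complex" and e :: "real \<Rightarrow> real" where
    "\<And>z. (E has_field_derivative exp (- z\<^sup>2)) (at z)"
    "\<And>s. E (of_real s) = of_real (e s)"
    "\<And>s. (e has_real_derivative exp (- s\<^sup>2)) (at s)" "e 0 = 0"
proof -
  have "(\<lambda>z::complex. exp (- z\<^sup>2)) holomorphic_on UNIV" by (intro holomorphic_intros)
  then obtain E0 :: "complex \<Rightarrow> complex" where E0: "\<And>z. (E0 has_field_derivative exp (- z\<^sup>2)) (at z)"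
    using holomorphic_convex_primitive'[of UNIV] by auto
  define E where "E = (\<lambda>z. E0 z - E0 0)"
  have E: "(E has_field_derivative exp (- z\<^sup>2)) (at z)" for z
    unfolding E_def by (auto intro!: derivative_eq_intros E0)
  have vd: "((\<lambda>s. E (of_real s)) has_vector_derivative of_real (exp (- s\<^sup>2))) (at s)" for s :: real
    using has_vector_derivative_real_field[OF has_field_derivative_at_within[OF E[of "of_real s"]], of UNIV]
    by (simp add: exp_of_real flip: of_real_power of_real_minus)
  have re: "((\<lambda>s. Re (E (of_real s))) has_real_derivative exp (- s\<^sup>2)) (at s)" for s :: real
    using has_field_derivative_Re[OF vd] by simp
  have im: "((\<lambda>s. Im (E (of_real s))) has_real_derivative 0) (at s)" for s :: real
    using has_field_derivative_Im[OF vd] by simp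
  have "Im (E (of_real s)) = Im (E (of_real 0))" for s :: real
    using im by (intro DERIV_isconst_all) auto
  then have "E (of_real s) = of_real (Re (E (of_real s)))" for s :: real
    by (simp add: complex_eq_iff E_def)
  then show ?thesis using that[of E "\<lambda>s. Re (E (of_real s))"] E re by (simp add: E_def)
qed

text \<open>
  The normalised primitive of the Gaussian. The decay \<open>1 / (1 + s\<^sup>2)\<close> is far from sharp; it is used since it has
  the bounded primitive \<open>arctan\<close>. The last estimate integrates \<open>exp (- z\<^sup>2)\<close> along the vertical segment from the
  real axis to \<open>z\<close>.
\<close>
lemma entire_step_function:
  obtains \<Phi> :: "complex \<Rightarrow> complex" and A :: real where
    "A > 0" "\<Phi> holomorphic_on UNIV"
    "\<And>s. Im (\<Phi> (of_real s)) = 0"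
    "\<And>s. \<bar>Re (\<Phi> (of_real s)) - (if 0 \<le> s then 1 else 0)\<bar> \<le> A / (1 + s\<^sup>2)"
    "\<And>z. \<bar>Im (\<Phi> z)\<bar> \<le> A * \<bar>Im z\<bar> * exp ((Im z)\<^sup>2) / (1 + (Re z)\<^sup>2)"
proof -
  obtain E :: "complex \<Rightarrow> complex" and e :: "real \<Rightarrow> real" where
    E: "\<And>z. (E has_field_derivative exp (- z\<^sup>2)) (at z)" and
    Ee: "\<And>s. E (of_real s) = of_real (e s)" and
    e: "\<And>s. (e has_real_derivative exp (- s\<^sup>2)) (at s)" and e0: "e 0 = 0"
    using entire_gaussian_primitive by blast
  have mono: "e s \<le> e t" if "s \<le> t" for s t
    by (rule DERIV_nonneg_imp_nondecreasing[OF that]) (use e in force)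
  \<comment> \<open>The tail of the Gaussian integral is compared with \<open>exp (1 - s)\<close>, whose derivative is larger
    in absolute value.\<close>
  have tail: "e t + exp (1 - t) \<le> e s + exp (1 - s)" if "s \<le> t" for s t
  proof (rule DERIV_nonpos_imp_nonincreasing[OF that])
    fix x :: real
    have "x * (1 - x) \<le> 1" using sum_squares_ge_zero[of "x - 1" x] by (simp add: algebra_simps power2_eq_square)
    then have "exp (- x\<^sup>2) \<le> exp (1 - x)" by (simp add: algebra_simps power2_eq_square)
    then show "\<exists>y. ((\<lambda>s. e s + exp (1 - s)) has_real_derivative y) (at x) \<and> y \<le> 0"
      by (intro exI[of _ "exp (- x\<^sup>2) - exp (1 - x)"]) (auto intro!: derivative_eq_intros e)
  qed
  have odd: "e (- s) = - e s" for s
  proof -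
    have "((\<lambda>s. e s + e (- s)) has_real_derivative 0) (at x)" for x
      by (auto intro!: derivative_eq_intros e DERIV_chain2[where f = e and g = uminus])
    then have "e s + e (- s) = e 0 + e (- 0)" by (intro DERIV_isconst_all[where f = "\<lambda>s. e s + e (- s)"]) auto
    then show ?thesis using e0 by simp
  qed
  define c where "c = (SUP s. e s)"
  have le: "e t \<le> e s + exp (1 - s)" for s t
    using mono[of t "max s t"] tail[of s "max s t"] exp_gt_zero[of "1 - max s t"] by linarith
  have bdd: "bdd_above (range e)" using le[of _ 0] by (auto intro!: bdd_aboveI2)
  have lec: "e s \<le> c" for s unfolding c_def by (rule cSUP_upper[OF _ bdd]) simp
  have ctail: "c - e s \<le> exp (1 - s)" for s
    using cSUP_least[of UNIV e "e s + exp (1 - s)"] le[of _ s] unfolding c_def by fastforce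
  have "e 0 < e 1" by (rule DERIV_pos_imp_increasing) (use e in force)+
  then have c: "c > 0" using lec[of 1] e0 by simp
  have quad: "exp (- s) \<le> 2 / (1 + s\<^sup>2)" if "s \<ge> 0" for s :: real
    using exp_lower_Taylor_quadratic[OF that] that
    by (simp add: exp_minus field_simps add_pos_nonneg)
  have ctail': "\<bar>c - e s\<bar> \<le> 2 * exp 1 / (1 + s\<^sup>2)" if "s \<ge> 0" for s
  proof -
    have "exp (1 - s) = exp 1 * exp (- s)" by (simp flip: exp_add)
    also have "\<dots> \<le> exp 1 * (2 / (1 + s\<^sup>2))" using quad[OF that] by (intro mult_left_mono) auto
    finally show ?thesis using ctail[of s] lec[of s] by (simp add: mult.commute)
  qed
  define \<Phi> where "\<Phi> = (\<lambda>z. 1 / 2 + E z / of_real (2 * c))"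
  define A where "A = exp 1 / c"
  show ?thesis
  proof (rule that[of A \<Phi>])
    show "A > 0" using c by (simp add: A_def)
    have "E holomorphic_on UNIV" using E
      by (meson holomorphic_onI field_differentiable_at_within field_differentiable_def)
    then show "\<Phi> holomorphic_on UNIV" unfolding \<Phi>_def using c by (intro holomorphic_intros) auto
    show "Im (\<Phi> (of_real s)) = 0" for s
      unfolding \<Phi>_def Ee by (simp flip: of_real_divide of_real_mult)
    show "\<bar>Re (\<Phi> (of_real s)) - (if 0 \<le> s then 1 else 0)\<bar> \<le> A / (1 + s\<^sup>2)" for s
    proof -
      have re: "Re (\<Phi> (of_real s)) = 1 / 2 + e s / (2 * c)"
        unfolding \<Phi>_def Ee by (simp flip: of_real_divide of_real_mult)
      have "\<bar>Re (\<Phi> (of_real s)) - (if 0 \<le> s then 1 else 0)\<bar> = \<bar>c - e \<bar>s\<bar>\<bar> / (2 * c)"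
      proof (cases "0 \<le> s")
        case True
        then have "\<bar>c - e s\<bar> = c - e s" using lec[of s] by simp
        moreover have "Re (\<Phi> (of_real s)) - 1 = - ((c - e s) / (2 * c))"
          unfolding re using c by (simp add: field_simps)
        ultimately show ?thesis using True c lec[of s] by simp
      next
        case False
        then have "e \<bar>s\<bar> = - e s" using odd[of s] by simp
        moreover have "Re (\<Phi> (of_real s)) = (c + e s) / (2 * c)"
          unfolding re using c by (simp add: field_simps)
        ultimately show ?thesis using False c by simp
      qed
      also have "\<dots> \<le> (2 * exp 1 / (1 + \<bar>s\<bar>\<^sup>2)) / (2 * c)"
        using c ctail'[of "\<bar>s\<bar>"] by (intro divide_right_mono) auto
      also have "\<dots> = A / (1 + s\<^sup>2)" by (simp add: A_def)
      finally show ?thesis .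
    qed
    show "\<bar>Im (\<Phi> z)\<bar> \<le> A * \<bar>Im z\<bar> * exp ((Im z)\<^sup>2) / (1 + (Re z)\<^sup>2)" for z
    proof -
      define a b where "a = Re z" and "b = Im z"
      have z: "z = Complex a b" by (simp add: a_def b_def)
      have "norm (E z - E (of_real a)) \<le> exp (b\<^sup>2) / exp (a\<^sup>2) * norm (z - of_real a)"
      proof (rule field_differentiable_bound[of "closed_segment (of_real a) z"])
        show "norm (exp (- w\<^sup>2)) \<le> exp (b\<^sup>2) / exp (a\<^sup>2)" if "w \<in> closed_segment (of_real a) z" for w
        proof -
          obtain u where u: "0 \<le> u" "u \<le> 1" "w = (1 - u) *\<^sub>R of_real a + u *\<^sub>R z"
            using \<open>w \<in> _\<close> by (auto simp: closed_segment_def)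
          have wr: "Re w = a" "Im w = u * b" by (auto simp: u(3) z algebra_simps)
          have "\<bar>u * b\<bar> \<le> \<bar>b\<bar>" using u by (simp add: abs_mult mult_left_le_one_le)
          then have "(u * b)\<^sup>2 \<le> b\<^sup>2" by (metis abs_le_square_iff)
          then have "exp ((u * b)\<^sup>2 - a\<^sup>2) \<le> exp (b\<^sup>2 - a\<^sup>2)" by simp
          then show ?thesis by (simp add: norm_exp_eq_Re wr power2_eq_square exp_diff)
        qed
      qed (auto intro: has_field_derivative_at_within[OF E])
      also have "norm (z - of_real a) = \<bar>b\<bar>" unfolding z by (simp add: cmod_def)
      finally have 1: "\<bar>Im (E z)\<bar> \<le> \<bar>b\<bar> * exp (b\<^sup>2) / exp (a\<^sup>2)"
        using abs_Im_le_cmod[of "E z - E (of_real a)"] by (simp add: Ee mult.commute)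
      have "1 + a\<^sup>2 \<le> exp (a\<^sup>2)" by (rule exp_ge_add_one_self)
      then have "\<bar>b\<bar> * exp (b\<^sup>2) / exp (a\<^sup>2) \<le> \<bar>b\<bar> * exp (b\<^sup>2) / (1 + a\<^sup>2)"
        by (intro divide_left_mono) (auto simp: add_pos_nonneg)
      with 1 have "\<bar>Im (E z)\<bar> \<le> \<bar>b\<bar> * exp (b\<^sup>2) / (1 + a\<^sup>2)" by simp
      then have "\<bar>Im (E z)\<bar> / (2 * c) \<le> \<bar>b\<bar> * exp (b\<^sup>2) / (1 + a\<^sup>2) / (2 * c)"
        using c by (intro divide_right_mono) auto
      moreover have "\<bar>Im (\<Phi> z)\<bar> = \<bar>Im (E z)\<bar> / (2 * c)"
        using c unfolding \<Phi>_def by (simp flip: of_real_mult add: Im_divide_of_real)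
      moreover have "\<bar>b\<bar> * exp (b\<^sup>2) / (1 + a\<^sup>2) / (2 * c) \<le> (exp 1 / c) * \<bar>b\<bar> * exp (b\<^sup>2) / (1 + a\<^sup>2)"
      proof -
        have "1 / (2 * c) \<le> exp 1 / c" using c exp_ge_add_one_self[of 1] by (simp add: field_simps)
        then have "1 / (2 * c) * (\<bar>b\<bar> * exp (b\<^sup>2) / (1 + a\<^sup>2)) \<le> exp 1 / c * (\<bar>b\<bar> * exp (b\<^sup>2) / (1 + a\<^sup>2))"
          by (intro mult_right_mono) auto
        then show ?thesis by (simp add: mult_ac)
      qed
      ultimately show ?thesis unfolding A_def a_def b_def by linarith
    qed
  qed
qed

section \<open>The hyperbolic coordinate along a radius\<close>

text \<open>
  The conformal map of the unit disc onto the strip \<open>\<bar>Im z\<bar> < \<pi> / 2\<close> that takes the diameter to the real line.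
\<close>
definition disc_to_strip :: "complex \<Rightarrow> complex" where
  "disc_to_strip z = Ln ((1 + z) / (1 - z))"

lemma Re_half_plane_pos:
  assumes "z \<in> \<D>" shows "Re ((1 + z) / (1 - z)) > 0"
proof -
  have "1 - z \<noteq> 0" using assms by auto
  then have n: "(Re (1 - z))\<^sup>2 + (Im (1 - z))\<^sup>2 > 0" by (metis complex_neq_0)
  have "norm z < 1" using assms by simp
  then have "(norm z)\<^sup>2 < 1" by (simp add: power_less_one_iff)
  then have "Re (1 + z) * Re (1 - z) + Im (1 + z) * Im (1 - z) > 0"
    unfolding cmod_power2 by (simp add: algebra_simps power2_eq_square)
  then show ?thesis unfolding Re_divide using n by (rule divide_pos_pos)
qed

lemma disc_to_strip_has_field_derivative:
  assumes "z \<in> \<D>"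
  shows "(disc_to_strip has_field_derivative 2 / (1 - z\<^sup>2)) (at z)"
proof -
  have z: "1 - z \<noteq> 0" "1 + z \<noteq> 0" using assms by (auto simp: add_eq_0_iff)
  have m: "1 - z\<^sup>2 = (1 + z) * (1 - z)" by (simp add: algebra_simps power2_eq_square)
  have "(1 + z) / (1 - z) \<notin> \<real>\<^sub>\<le>\<^sub>0"
    using Re_half_plane_pos[OF assms] complex_nonpos_Reals_iff by force
  then have L: "(Ln has_field_derivative inverse ((1 + z) / (1 - z))) (at ((1 + z) / (1 - z)))"
    by (rule has_field_derivative_Ln)
  have "((\<lambda>z. (1 + z) / (1 - z)) has_field_derivative 2 / ((1 - z) * (1 - z))) (at z)"
    using z by (auto intro!: derivative_eq_intros simp: algebra_simps)
  from DERIV_chain2[OF L this]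
  have "(disc_to_strip has_field_derivative inverse ((1 + z) / (1 - z)) * (2 / ((1 - z) * (1 - z)))) (at z)"
    unfolding disc_to_strip_def .
  also have "inverse ((1 + z) / (1 - z)) * (2 / ((1 - z) * (1 - z))) = 2 / (1 - z\<^sup>2)"
    unfolding m using z by (simp add: divide_simps)
  finally show ?thesis .
qed

lemma disc_to_strip_holomorphic: "disc_to_strip holomorphic_on \<D>"
  using disc_to_strip_has_field_derivative
  by (meson holomorphic_onI field_differentiable_at_within field_differentiable_def)

lemma abs_Im_disc_to_strip:
  assumes "z \<in> \<D>" shows "\<bar>Im (disc_to_strip z)\<bar> < pi / 2"
  using Re_half_plane_pos[OF assms] Re_Ln_pos_lt[of "(1 + z) / (1 - z)"]
  by (force simp: disc_to_strip_def)

lemma disc_to_strip_of_real: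
  assumes "\<bar>r\<bar> < 1"
  shows "disc_to_strip (of_real r) = of_real (ln ((1 + r) / (1 - r)))"
proof -
  have "(1 + r) / (1 - r) > 0" using assms by simp
  then show ?thesis unfolding disc_to_strip_def
    using Ln_of_real[of "(1 + r) / (1 - r)"] by simp
qed

lemma has_real_derivative_hyperbolic_coordinate:
  assumes "\<bar>r\<bar> < (1::real)"
  shows "((\<lambda>r. ln ((1 + r) / (1 - r))) has_real_derivative 2 / (1 - r\<^sup>2)) (at r)"
proof -
  have m: "1 - r\<^sup>2 = (1 + r) * (1 - r)" by (simp add: algebra_simps power2_eq_square)
  have r: "1 + r > 0" "1 - r > 0" using assms by auto
  have "((\<lambda>r. ln (1 + r) - ln (1 - r)) has_real_derivative 1 / (1 + r) + 1 / (1 - r)) (at r)"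
    using r by (auto intro!: derivative_eq_intros)
  also have "1 / (1 + r) + 1 / (1 - r) = 2 / (1 - r\<^sup>2)" unfolding m using r by (simp add: divide_simps)
  finally show ?thesis
    by (rule has_field_derivative_transform_within_open[where S = "{-1<..<1}"])
      (use assms in \<open>auto simp: ln_div\<close>)
qed

text \<open>
  In the hyperbolic coordinate this is the integral of \<open>1 / (1 + N\<^sup>2 (x - s)\<^sup>2)\<close>, and
  \<open>\<pi> / N\<close> is its value over the whole line. The bound does not depend on \<open>R\<close> or \<open>x\<close>.
\<close>
lemma integral_hyperbolic_Poisson_bound:
  assumes "0 \<le> R" "R < 1" "N > 0"
  defines "s \<equiv> \<lambda>\<rho>. ln ((1 + \<rho>) / (1 - \<rho>))"
  shows "(\<lambda>\<rho>. 2 / (1 - \<rho>\<^sup>2) / (1 + (N * (x - s \<rho>))\<^sup>2)) integrable_on {0..R}"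
    and "integral {0..R} (\<lambda>\<rho>. 2 / (1 - \<rho>\<^sup>2) / (1 + (N * (x - s \<rho>))\<^sup>2)) \<le> pi / N"
proof -
  have der: "((\<lambda>\<rho>. - arctan (N * (x - s \<rho>)) / N) has_vector_derivative
      2 / (1 - \<rho>\<^sup>2) / (1 + (N * (x - s \<rho>))\<^sup>2)) (at \<rho> within {0..R})" if "\<rho> \<in> {0..R}" for \<rho>
  proof -
    have s: "(s has_real_derivative 2 / (1 - \<rho>\<^sup>2)) (at \<rho>)"
      unfolding s_def using that \<open>R < 1\<close> by (intro has_real_derivative_hyperbolic_coordinate) auto
    have alg: "- (inverse a * (N * (0 - b))) / N = b / a" for a b :: real
      using \<open>N > 0\<close> by (simp add: divide_inverse)
    have a: "((\<lambda>\<rho>. N * (x - s \<rho>)) has_real_derivative N * (0 - 2 / (1 - \<rho>\<^sup>2))) (at \<rho>)"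
      by (intro DERIV_cmult DERIV_diff DERIV_const s)
    have "((\<lambda>\<rho>. - arctan (N * (x - s \<rho>)) / N) has_real_derivative
      - (inverse (1 + (N * (x - s \<rho>))\<^sup>2) * (N * (0 - 2 / (1 - \<rho>\<^sup>2)))) / N) (at \<rho>)"
      by (intro DERIV_cdivide DERIV_minus DERIV_chain2[OF DERIV_arctan a])
    also have "- (inverse (1 + (N * (x - s \<rho>))\<^sup>2) * (N * (0 - 2 / (1 - \<rho>\<^sup>2)))) / N =
      2 / (1 - \<rho>\<^sup>2) / (1 + (N * (x - s \<rho>))\<^sup>2)"
      using alg .
    finally have "((\<lambda>\<rho>. - arctan (N * (x - s \<rho>)) / N) has_real_derivative
      2 / (1 - \<rho>\<^sup>2) / (1 + (N * (x - s \<rho>))\<^sup>2)) (at \<rho>)" .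
    then show ?thesis
      unfolding has_real_derivative_iff_has_vector_derivative by (rule has_vector_derivative_at_within)
  qed
  have I: "((\<lambda>\<rho>. 2 / (1 - \<rho>\<^sup>2) / (1 + (N * (x - s \<rho>))\<^sup>2)) has_integral
     (- arctan (N * (x - s R)) / N - - arctan (N * (x - s 0)) / N)) {0..R}"
    by (rule fundamental_theorem_of_calculus[OF \<open>0 \<le> R\<close> der])
  then show "(\<lambda>\<rho>. 2 / (1 - \<rho>\<^sup>2) / (1 + (N * (x - s \<rho>))\<^sup>2)) integrable_on {0..R}"
    by (rule has_integral_integrable)
  have "arctan (N * (x - s 0)) - arctan (N * (x - s R)) \<le> pi"
    using arctan_ubound[of "N * (x - s 0)"] arctan_lbound[of "N * (x - s R)"] by linarith
  then have "(arctan (N * (x - s 0)) - arctan (N * (x - s R))) / N \<le> pi / N"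
    using \<open>N > 0\<close> by (intro divide_right_mono) auto
  then show "integral {0..R} (\<lambda>\<rho>. 2 / (1 - \<rho>\<^sup>2) / (1 + (N * (x - s \<rho>))\<^sup>2)) \<le> pi / N"
    unfolding integral_unique[OF I] diff_divide_distrib by linarith
qed

section \<open>Functions cancelling the phase of a univalent derivative\<close>

text \<open>
  The function \<open>\<omega>\<close> is the derivative of the phase with respect to \<open>r\<close>, and the bound on it says that the phase is
  \<open>C\<close>-Lipschitz in the hyperbolic coordinate. The primitive of \<open>\<omega>\<close> is the integral of \<open>\<omega>(\<rho>)\<close> against the step
  function that jumps at \<open>\<rho>\<close>; replacing the step by the entire step function, sharpened by a factor \<open>N\<close>, gives
  \<open>F\<close>. The error is of order \<open>1 / N\<close>. The bound \<open>K\<close> grows with \<open>N\<close> but is independent of \<open>\<omega>\<close> and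
  \<open>R\<close>.
\<close>
lemma holomorphic_approximation_of_phase:
  fixes C \<epsilon> :: real
  assumes "C > 0" "\<epsilon> > 0"
  shows "\<exists>K. \<forall>\<omega> R. 0 \<le> R \<and> R < 1 \<and> continuous_on {0..R} \<omega> \<and>
      (\<forall>\<rho>\<in>{0..R}. \<bar>\<omega> \<rho>\<bar> \<le> C * (2 / (1 - \<rho>\<^sup>2))) \<longrightarrow>
      (\<exists>F. F holomorphic_on \<D> \<and> (\<forall>z\<in>\<D>. \<bar>Im (F z)\<bar> \<le> K) \<and>
        (\<forall>r\<in>{0..R}. Im (F (of_real r)) = 0 \<and> \<bar>Re (F (of_real r)) - integral {0..r} \<omega>\<bar> \<le> \<epsilon>))"
proof -
  obtain \<Phi> :: "complex \<Rightarrow> complex" and A :: real where A: "A > 0" and hol\<Phi>: "\<Phi> holomorphic_on UNIV" and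
    \<Phi>real: "\<And>s. Im (\<Phi> (of_real s)) = 0" and
    \<Phi>step: "\<And>s. \<bar>Re (\<Phi> (of_real s)) - (if 0 \<le> s then 1 else 0)\<bar> \<le> A / (1 + s\<^sup>2)" and
    \<Phi>Im: "\<And>z. \<bar>Im (\<Phi> z)\<bar> \<le> A * \<bar>Im z\<bar> * exp ((Im z)\<^sup>2) / (1 + (Re z)\<^sup>2)"
    by (rule entire_step_function) (rule that)
  \<comment> \<open>The choice of \<open>N\<close> makes the final error \<open>C * A * (pi / N)\<close> equal to \<open>\<epsilon>\<close>. The number \<open>B\<close> bounds the numerator
    of the imaginary part of the sharpened step on the strip, where \<open>\<bar>Im\<bar> \<le> N * pi / 2\<close> after scaling.\<close>
  define N where "N = C * A * pi / \<epsilon>"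
  have N: "N > 0" using A assms by (simp add: N_def)
  define B where "B = A * (N * pi / 2) * exp ((N * pi / 2)\<^sup>2)"
  have B: "B \<ge> 0" using A N by (simp add: B_def)
  define s where "s = (\<lambda>\<rho>::real. ln ((1 + \<rho>) / (1 - \<rho>)))"
  show ?thesis
  proof (intro exI[of _ "C * B * (pi / N)"] allI impI, elim conjE)
    fix \<omega> :: "real \<Rightarrow> real" and R :: real
    assume R: "0 \<le> R" "R < 1" and cont: "continuous_on {0..R} \<omega>"
      and "\<forall>\<rho>\<in>{0..R}. \<bar>\<omega> \<rho>\<bar> \<le> C * (2 / (1 - \<rho>\<^sup>2))"
    then have \<omega>: "\<bar>\<omega> \<rho>\<bar> \<le> C * (2 / (1 - \<rho>\<^sup>2))" if "\<rho> \<in> {0..R}" for \<rho> using that by blast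
    define ker where "ker = (\<lambda>z \<rho>. of_real (\<omega> \<rho>) * \<Phi> (of_real N * (disc_to_strip z - of_real (s \<rho>))))"
    define F where "F = (\<lambda>z. integral (cbox 0 R) (ker z))"
    have conts: "continuous_on {0..R} s"
      unfolding s_def using R by (intro continuous_intros) auto
    have cont\<Phi>: "continuous_on X \<Phi>" for X using hol\<Phi> holomorphic_on_imp_continuous_on continuous_on_subset by blast
    have hold: "deriv \<Phi> holomorphic_on UNIV" using hol\<Phi> by (intro holomorphic_deriv) auto
    then have contd: "continuous_on X (deriv \<Phi>)" for X
      using holomorphic_on_imp_continuous_on continuous_on_subset by blast
    have contstrip: "continuous_on \<D> disc_to_strip"
      using disc_to_strip_holomorphic by (rule holomorphic_on_imp_continuous_on)
    have contker: "continuous_on {0..R} (ker z)" for z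
      unfolding ker_def by (intro continuous_intros cont conts continuous_on_compose2[OF cont\<Phi>[of UNIV]]) auto
    have intker: "ker z integrable_on {0..R}" for z
      using contker by (rule integrable_continuous_interval)
    have holF: "F holomorphic_on \<D>"
      unfolding F_def
    proof (rule leibniz_rule_holomorphic)
      fix z \<rho> assume z: "z \<in> \<D>"
      have 1: "(\<Phi> has_field_derivative deriv \<Phi> w) (at w)" for w
        using holomorphic_derivI[OF hol\<Phi>] by auto
      have 2: "((\<lambda>z. of_real N * (disc_to_strip z - of_real (s \<rho>))) has_field_derivative
          of_real N * (2 / (1 - z\<^sup>2))) (at z)"
        by (auto intro!: derivative_eq_intros disc_to_strip_has_field_derivative z)
      show "((\<lambda>z. ker z \<rho>) has_field_derivative
         of_real (\<omega> \<rho>) * (deriv \<Phi> (of_real N * (disc_to_strip z - of_real (s \<rho>))) * (of_real N * (2 / (1 - z\<^sup>2)))))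
         (at z within \<D>)"
        unfolding ker_def
        by (intro has_field_derivative_at_within[OF DERIV_cmult] DERIV_chain2[OF 1 2])
    next
      have nz: "1 - z\<^sup>2 \<noteq> 0" if "z \<in> \<D>" for z :: complex
      proof
        assume "1 - z\<^sup>2 = 0"
        then have "z\<^sup>2 = 1" by simp
        then have "norm z ^ 2 = 1" by (metis norm_one norm_power)
        then show False using that by (simp add: abs_square_eq_1)
      qed
      have f: "continuous_on (\<D> \<times> {0..R}) (\<lambda>x. h (fst x))" if "continuous_on \<D> h" for h :: "complex \<Rightarrow> complex"
        using that by (rule continuous_on_compose2) (auto intro: continuous_intros)
      have g: "continuous_on (\<D> \<times> {0..R}) (\<lambda>x. of_real (h (snd x)) :: complex)" if "continuous_on {0..R} h" for h :: "real \<Rightarrow> real"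
        by (intro continuous_intros continuous_on_compose2[OF that]) auto
      show "continuous_on (\<D> \<times> cbox 0 R) (\<lambda>(z, \<rho>).
         of_real (\<omega> \<rho>) * (deriv \<Phi> (of_real N * (disc_to_strip z - of_real (s \<rho>))) * (of_real N * (2 / (1 - z\<^sup>2)))))"
        unfolding case_prod_beta cbox_interval
        by (intro continuous_intros continuous_on_compose2[OF contd[of UNIV]] f[OF contstrip] g cont conts)
          (use nz in auto)
    qed (use intker in auto)
    have bound: "integral {0..R} (\<lambda>\<rho>. \<bar>\<omega> \<rho>\<bar> * (B' / (1 + (N * (x - s \<rho>))\<^sup>2))) \<le> C * B' * (pi / N)"
      if "B' \<ge> 0" for B' x
    proof -
      have "integral {0..R} (\<lambda>\<rho>. \<bar>\<omega> \<rho>\<bar> * (B' / (1 + (N * (x - s \<rho>))\<^sup>2)))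
        \<le> integral {0..R} (\<lambda>\<rho>. C * B' * (2 / (1 - \<rho>\<^sup>2) / (1 + (N * (x - s \<rho>))\<^sup>2)))"
      proof (rule integral_le)
        have nz: "1 + y\<^sup>2 \<noteq> 0" for y :: real using zero_le_power2[of y] by linarith
        show "(\<lambda>\<rho>. \<bar>\<omega> \<rho>\<bar> * (B' / (1 + (N * (x - s \<rho>))\<^sup>2))) integrable_on {0..R}"
          by (intro integrable_continuous_interval continuous_intros cont conts) (use nz in auto)
        show "(\<lambda>\<rho>. C * B' * (2 / (1 - \<rho>\<^sup>2) / (1 + (N * (x - s \<rho>))\<^sup>2))) integrable_on {0..R}"
          unfolding s_def using integral_hyperbolic_Poisson_bound(1)[OF R N]
          by (intro integrable_on_mult_right) 
        show "\<bar>\<omega> \<rho>\<bar> * (B' / (1 + (N * (x - s \<rho>))\<^sup>2)) \<le> C * B' * (2 / (1 - \<rho>\<^sup>2) / (1 + (N * (x - s \<rho>))\<^sup>2))"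
          if "\<rho> \<in> {0..R}" for \<rho>
          using mult_right_mono[OF \<omega>[OF that], of "B' / (1 + (N * (x - s \<rho>))\<^sup>2)"] \<open>B' \<ge> 0\<close>
          by (simp add: mult_ac)
      qed
      also have "\<dots> = C * B' * integral {0..R} (\<lambda>\<rho>. 2 / (1 - \<rho>\<^sup>2) / (1 + (N * (x - s \<rho>))\<^sup>2))"
        by (rule integral_mult_right)
      also have "\<dots> \<le> C * B' * (pi / N)"
        unfolding s_def using assms that by (intro mult_left_mono integral_hyperbolic_Poisson_bound(2)[OF R N]) auto
      finally show ?thesis .
    qed
    have intb: "(\<lambda>\<rho>. \<bar>\<omega> \<rho>\<bar> * (B' / (1 + (N * (x - s \<rho>))\<^sup>2))) integrable_on {0..R}" for B' x
    proof -
      have nz: "1 + y\<^sup>2 \<noteq> 0" for y :: real using zero_le_power2[of y] by linarith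
      show ?thesis by (intro integrable_continuous_interval continuous_intros cont conts) (use nz in auto)
    qed
    have ImF: "Im (F z) = integral {0..R} (\<lambda>\<rho>. \<omega> \<rho> * Im (\<Phi> (of_real N * (disc_to_strip z - of_real (s \<rho>)))))" for z
      using integral_unique[OF has_integral_Im[OF integrable_integral[OF intker[of z]]]]
      by (simp add: F_def ker_def)
    have ReF: "((\<lambda>\<rho>. \<omega> \<rho> * Re (\<Phi> (of_real N * (disc_to_strip z - of_real (s \<rho>))))) has_integral Re (F z)) {0..R}" for z
      using has_integral_Re[OF integrable_integral[OF intker[of z]]]
      by (simp add: F_def ker_def)
    have real: "of_real N * (disc_to_strip (of_real r) - of_real (s \<rho>)) = of_real (N * (s r - s \<rho>))"
      if "r \<in> {0..R}" for r \<rho>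
      using disc_to_strip_of_real[of r] that R by (simp add: s_def)
    have Im: "\<bar>Im (F z)\<bar> \<le> C * B * (pi / N)" if z: "z \<in> \<D>" for z
    proof -
      define x y where "x = Re (disc_to_strip z)" and "y = Im (disc_to_strip z)"
      have y: "\<bar>N * y\<bar> \<le> N * pi / 2"
        using abs_Im_disc_to_strip[OF z] N by (simp add: y_def abs_mult)
      have y2: "(N * y)\<^sup>2 \<le> (N * pi / 2)\<^sup>2"
        using power_mono[OF y, of 2] by simp
      have "norm (integral {0..R} (\<lambda>\<rho>. \<omega> \<rho> * Im (\<Phi> (of_real N * (disc_to_strip z - of_real (s \<rho>))))))
        \<le> integral {0..R} (\<lambda>\<rho>. \<bar>\<omega> \<rho>\<bar> * (B / (1 + (N * (x - s \<rho>))\<^sup>2)))"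
      proof (rule integral_norm_bound_integral[OF _ intb])
        show "(\<lambda>\<rho>. \<omega> \<rho> * Im (\<Phi> (of_real N * (disc_to_strip z - of_real (s \<rho>))))) integrable_on {0..R}"
          by (intro integrable_continuous_interval continuous_intros cont conts continuous_on_compose2[OF cont\<Phi>[of UNIV]]) auto
        show "norm (\<omega> \<rho> * Im (\<Phi> (of_real N * (disc_to_strip z - of_real (s \<rho>)))))
          \<le> \<bar>\<omega> \<rho>\<bar> * (B / (1 + (N * (x - s \<rho>))\<^sup>2))" for \<rho>
        proof -
          have "\<bar>Im (\<Phi> (of_real N * (disc_to_strip z - of_real (s \<rho>))))\<bar>
            \<le> A * \<bar>N * y\<bar> * exp ((N * y)\<^sup>2) / (1 + (N * (x - s \<rho>))\<^sup>2)"
            using \<Phi>Im[of "of_real N * (disc_to_strip z - of_real (s \<rho>))"] by (simp add: x_def y_def)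
          also have "\<dots> \<le> B / (1 + (N * (x - s \<rho>))\<^sup>2)"
            unfolding B_def using A y y2 
            by (intro divide_right_mono mult_mono) (auto simp: add_nonneg_nonneg)
          finally show ?thesis unfolding real_norm_def abs_mult by (rule mult_left_mono) simp
        qed
      qed
      then show ?thesis using bound[OF B, of x] by (simp add: ImF)
    qed
    have onray: "Im (F (of_real r)) = 0" "\<bar>Re (F (of_real r)) - integral {0..r} \<omega>\<bar> \<le> \<epsilon>"
      if r: "r \<in> {0..R}" for r
    proof -
      show "Im (F (of_real r)) = 0"
        unfolding ImF real[OF r] \<Phi>real by simp
      have s_le: "0 \<le> s r - s \<rho> \<longleftrightarrow> \<rho> \<in> {0..r}" if "\<rho> \<in> {0..R}" for \<rho>
      proof -
        have "(s \<rho> \<le> s r) = ((1 + \<rho>) / (1 - \<rho>) \<le> (1 + r) / (1 - r))"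
          unfolding s_def using that r R by (intro ln_le_cancel_iff) auto
        also have "\<dots> = (\<rho> \<le> r)" using that r R by (simp add: field_simps)
        finally show ?thesis using that by simp
      qed
      have "(\<omega> has_integral integral {0..r} \<omega>) {0..r}"
        using r by (intro integrable_integral integrable_continuous_interval continuous_on_subset[OF cont]) auto
      then have step: "((\<lambda>\<rho>. if \<rho> \<in> {0..r} then \<omega> \<rho> else 0) has_integral integral {0..r} \<omega>) {0..R}"
        using r by (subst has_integral_restrict) auto
      have "norm (Re (F (of_real r)) - integral {0..r} \<omega>)
        = norm (integral {0..R} (\<lambda>\<rho>. \<omega> \<rho> * Re (\<Phi> (of_real (N * (s r - s \<rho>)))) - (if \<rho> \<in> {0..r} then \<omega> \<rho> else 0)))"
        using integral_unique[OF has_integral_diff[OF ReF[of "of_real r"] step]] unfolding real[OF r] by simp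
      also have "\<dots> \<le> integral {0..R} (\<lambda>\<rho>. \<bar>\<omega> \<rho>\<bar> * (A / (1 + (N * (s r - s \<rho>))\<^sup>2)))"
      proof (rule integral_norm_bound_integral[OF _ intb])
        show "(\<lambda>\<rho>. \<omega> \<rho> * Re (\<Phi> (of_real (N * (s r - s \<rho>)))) - (if \<rho> \<in> {0..r} then \<omega> \<rho> else 0)) integrable_on {0..R}"
          using has_integral_diff[OF ReF[of "of_real r"] step] unfolding real[OF r] by (rule has_integral_integrable)
        fix \<rho> assume \<rho>: "\<rho> \<in> {0..R}"
        have "\<omega> \<rho> * Re (\<Phi> (of_real (N * (s r - s \<rho>)))) - (if \<rho> \<in> {0..r} then \<omega> \<rho> else 0)
          = \<omega> \<rho> * (Re (\<Phi> (of_real (N * (s r - s \<rho>)))) - (if 0 \<le> N * (s r - s \<rho>) then 1 else 0))"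
          using s_le[OF \<rho>] N by (auto simp: algebra_simps zero_le_mult_iff)
        then show "norm (\<omega> \<rho> * Re (\<Phi> (of_real (N * (s r - s \<rho>)))) - (if \<rho> \<in> {0..r} then \<omega> \<rho> else 0))
          \<le> \<bar>\<omega> \<rho>\<bar> * (A / (1 + (N * (s r - s \<rho>))\<^sup>2))"
          using mult_left_mono[OF \<Phi>step[of "N * (s r - s \<rho>)"], of "\<bar>\<omega> \<rho>\<bar>"] by (simp only: real_norm_def abs_mult)
      qed
      also have "\<dots> \<le> C * A * (pi / N)" using bound[of A "s r"] A by simp
      also have "\<dots> = \<epsilon>" using A assms by (simp add: N_def)
      finally show "\<bar>Re (F (of_real r)) - integral {0..r} \<omega>\<bar> \<le> \<epsilon>" by simp
    qed
    show "\<exists>F. F holomorphic_on \<D> \<and> (\<forall>z\<in>\<D>. \<bar>Im (F z)\<bar> \<le> C * B * (pi / N)) \<and>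
        (\<forall>r\<in>{0..R}. Im (F (of_real r)) = 0 \<and> \<bar>Re (F (of_real r)) - integral {0..r} \<omega>\<bar> \<le> \<epsilon>)"
      using holF Im onray by blast
  qed
qed

text \<open>
  With \<open>\<epsilon> = 1\<close> the argument of \<open>p * deriv f\<close> stays in \<open>[- 1, 1]\<close> on the segment, which is inside the right half-plane.
  It matters that \<open>M\<close> is chosen before \<open>f\<close> and \<open>R\<close>: the lemma is applied to all rotations of one function and to
  \<open>R\<close> tending to 1.
\<close>
lemma univalent_phase_cancelling_function:
  shows "\<exists>M. \<forall>f R. f holomorphic_on \<D> \<and> inj_on f \<D> \<and> 0 \<le> R \<and> R < 1 \<longrightarrow>
     (\<exists>p. p holomorphic_on \<D> \<and> (\<forall>z\<in>\<D>. norm (p z) \<le> M) \<and>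
       (\<forall>r\<in>{0..R}. cos 1 * norm (deriv f (of_real r)) \<le> Re (p (of_real r) * deriv f (of_real r))))"
proof -
  obtain C where C: "C > 0" and pre: "\<And>f a. \<lbrakk>f holomorphic_on \<D>; inj_on f \<D>; a \<in> \<D>\<rbrakk>
      \<Longrightarrow> norm (deriv (deriv f) a / deriv f a) \<le> C / (1 - norm a)"
    by (rule univalent_pre_schwarzian_bound) (rule that)
  obtain K where K: "\<forall>\<omega> R. 0 \<le> R \<and> R < 1 \<and> continuous_on {0..R} \<omega> \<and>
      (\<forall>\<rho>\<in>{0..R}. \<bar>\<omega> \<rho>\<bar> \<le> C * (2 / (1 - \<rho>\<^sup>2))) \<longrightarrow>
      (\<exists>F. F holomorphic_on \<D> \<and> (\<forall>z\<in>\<D>. \<bar>Im (F z)\<bar> \<le> K) \<and>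
        (\<forall>r\<in>{0..R}. Im (F (of_real r)) = 0 \<and> \<bar>Re (F (of_real r)) - integral {0..r} \<omega>\<bar> \<le> 1))"
    using holomorphic_approximation_of_phase[OF C zero_less_one] ..
  show ?thesis
  proof (intro exI[of _ "exp K"] allI impI, elim conjE)
    fix f :: "complex \<Rightarrow> complex" and R :: real
    assume f: "f holomorphic_on \<D>" "inj_on f \<D>" and R: "0 \<le> R" "R < 1"
    have hold: "deriv f holomorphic_on \<D>" using f(1) by (intro holomorphic_deriv) auto
    have df: "deriv f z \<noteq> 0" if "z \<in> \<D>" for z
      using holomorphic_injective_imp_regular[OF f(1) _ f(2) that] by simp
    obtain l where l: "l holomorphic_on \<D>" "\<And>z. z \<in> \<D> \<Longrightarrow> exp (l z) = deriv f z"
      using holomorphic_logarithm_exists[OF convex_ball open_ball hold df, of 0] by auto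
    have dl: "(l has_field_derivative deriv (deriv f) z / deriv f z) (at z)" if z: "z \<in> \<D>" for z
    proof -
      have L: "(l has_field_derivative deriv l z) (at z)" using holomorphic_derivI[OF l(1) _ z] by simp
      have "((\<lambda>z. exp (l z)) has_field_derivative exp (l z) * deriv l z) (at z)"
        by (auto intro!: derivative_eq_intros L)
      then have "(deriv f has_field_derivative exp (l z) * deriv l z) (at z)"
        by (rule has_field_derivative_transform_within_open[where S = \<D>]) (use l(2) z in auto)
      then have "deriv (deriv f) z = deriv f z * deriv l z" using l(2)[OF z] by (simp add: DERIV_imp_deriv)
      then show ?thesis using L df[OF z] by simp
    qed
    define \<omega> where "\<omega> = (\<lambda>r. Im (deriv (deriv f) (of_real r) / deriv f (of_real r)))"
    have inD: "complex_of_real r \<in> \<D>" if "r \<in> {0..R}" for r using that R by auto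
    have cont: "continuous_on {0..R} \<omega>"
    proof -
      have "continuous_on \<D> (\<lambda>z. deriv (deriv f) z / deriv f z)"
        using hold df f(1) by (intro holomorphic_on_imp_continuous_on holomorphic_intros) auto
      then have "continuous_on {0..R} (\<lambda>r. deriv (deriv f) (of_real r) / deriv f (of_real r))"
        by (rule continuous_on_compose2) (use inD in \<open>auto intro: continuous_intros\<close>)
      then show ?thesis unfolding \<omega>_def by (rule continuous_on_Im)
    qed
    have bd: "\<bar>\<omega> r\<bar> \<le> C * (2 / (1 - r\<^sup>2))" if r: "r \<in> {0..R}" for r
    proof -
      have "\<bar>\<omega> r\<bar> \<le> C / (1 - r)"
        using abs_Im_le_cmod[of "deriv (deriv f) (of_real r) / deriv f (of_real r)"] pre[OF f inD[OF r]] r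
        unfolding \<omega>_def by simp
      also have "\<dots> \<le> C * (2 / (1 - r\<^sup>2))"
      proof -
        have m: "1 - r\<^sup>2 = (1 + r) * (1 - r)" by (simp add: algebra_simps power2_eq_square)
        have "1 / (1 - r) \<le> 2 / (1 + r) / (1 - r)" using r R by (intro divide_right_mono) auto
        then have "1 / (1 - r) \<le> 2 / (1 - r\<^sup>2)" unfolding m by simp
        from mult_left_mono[OF this, of C] show ?thesis using C by simp
      qed
      finally show ?thesis .
    qed
    obtain F where F: "F holomorphic_on \<D>" "\<And>z. z \<in> \<D> \<Longrightarrow> \<bar>Im (F z)\<bar> \<le> K"
      "\<And>r. r \<in> {0..R} \<Longrightarrow> Im (F (of_real r)) = 0"
      "\<And>r. r \<in> {0..R} \<Longrightarrow> \<bar>Re (F (of_real r)) - integral {0..r} \<omega>\<bar> \<le> 1"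
      using K[rule_format, of R \<omega>] R cont bd by blast
    have int\<omega>: "integral {0..r} \<omega> = Im (l (of_real r)) - Im (l 0)" if r: "r \<in> {0..R}" for r
    proof -
      have "((\<lambda>\<rho>. Im (l (of_real \<rho>))) has_vector_derivative \<omega> \<rho>) (at \<rho> within {0..r})" if "\<rho> \<in> {0..r}" for \<rho>
      proof -
        have "complex_of_real \<rho> \<in> \<D>" using inD[of \<rho>] that r by simp
        then have "((\<lambda>\<rho>. l (of_real \<rho>)) has_vector_derivative deriv (deriv f) (of_real \<rho>) / deriv f (of_real \<rho>)) (at \<rho> within {0..r})"
          by (intro has_vector_derivative_real_field has_field_derivative_at_within[OF dl])
        from has_field_derivative_Im[OF this] show ?thesis
          unfolding \<omega>_def by (simp add: has_real_derivative_iff_has_vector_derivative)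
      qed
      then have "(\<omega> has_integral Im (l (of_real r)) - Im (l (of_real 0))) {0..r}"
        using r by (intro fundamental_theorem_of_calculus) auto
      then show ?thesis by (simp add: integral_unique)
    qed
    define p where "p = (\<lambda>z. exp (- \<i> * (F z + of_real (Im (l 0)))))"
    have "p holomorphic_on \<D>" unfolding p_def by (intro holomorphic_intros F)
    moreover have "norm (p z) \<le> exp K" if "z \<in> \<D>" for z
      using F(2)[OF that] by (simp add: p_def)
    moreover have "cos 1 * norm (deriv f (of_real r)) \<le> Re (p (of_real r) * deriv f (of_real r))"
      if r: "r \<in> {0..R}" for r
    proof -
      define d where "d = Im (l (of_real r)) - Im (l 0) - Re (F (of_real r))"
      have d: "\<bar>d\<bar> \<le> 1" using F(4)[OF r] int\<omega>[OF r] by (simp add: d_def)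
      have "p (of_real r) * deriv f (of_real r) = exp (l (of_real r) - \<i> * (F (of_real r) + of_real (Im (l 0))))"
        unfolding p_def l(2)[OF inD[OF r], symmetric] exp_add[symmetric] by (simp add: algebra_simps)
      also have "Re \<dots> = exp (Re (l (of_real r))) * cos d"
        using F(3)[OF r] by (simp add: Re_exp d_def algebra_simps)
      also have "exp (Re (l (of_real r))) = norm (deriv f (of_real r))"
        unfolding l(2)[OF inD[OF r], symmetric] by simp
      finally have "Re (p (of_real r) * deriv f (of_real r)) = norm (deriv f (of_real r)) * cos d" .
      moreover have "cos 1 \<le> cos d"
        using cos_monotone_0_pi_le[of "\<bar>d\<bar>" 1] d pi_gt3 by (simp add: cos_abs_real)
      ultimately show ?thesis
        using mult_right_mono[of "cos 1" "cos d" "norm (deriv f (of_real r))"] by (simp only: mult.commute norm_ge_zero)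
    qed
    ultimately show "\<exists>p. p holomorphic_on \<D> \<and> (\<forall>z\<in>\<D>. norm (p z) \<le> exp K) \<and>
       (\<forall>r\<in>{0..R}. cos 1 * norm (deriv f (of_real r)) \<le> Re (p (of_real r) * deriv f (of_real r)))"
      by blast
  qed
qed

section \<open>The Volterra operator on the weighted spaces\<close>

lemma volterra_0: "volterra g f 0 = 0"
  by (simp add: volterra_def)

lemma volterra_has_field_derivative:
  assumes "g holomorphic_on \<D>" "f \<in> hol_disc" "z \<in> \<D>"
  shows "(volterra g f has_field_derivative f z * deriv g z) (at z)"
proof -
  have hol: "(\<lambda>z. f z * deriv g z) holomorphic_on \<D>"
    using assms unfolding hol_disc_def by (intro holomorphic_intros) auto
  show ?thesis
  proof (rule holomorphic_convex_primitive'[OF convex_ball open_ball hol])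
    fix P assume P: "\<And>z. z \<in> \<D> \<Longrightarrow> (P has_field_derivative f z * deriv g z) (at z within \<D>)"
    have P': "(P has_field_derivative f z * deriv g z) (at z)" if "z \<in> \<D>" for z
      using P[OF that] that at_within_open[of z \<D>] by simp
    have eq: "volterra g f z = P z - P 0" if "z \<in> \<D>" for z
    proof -
      have "closed_segment 0 z \<subseteq> \<D>" using that by (intro closed_segment_subset) auto
      then have "((\<lambda>\<xi>. f \<xi> * deriv g \<xi>) has_contour_integral P z - P 0) (linepath 0 z)"
        using contour_integral_primitive[of \<D> P "\<lambda>\<xi>. f \<xi> * deriv g \<xi>" "linepath 0 z"] P by simp
      then show ?thesis using that by (simp add: volterra_def contour_integral_unique)
    qed
    have "((\<lambda>z. P z - P 0) has_field_derivative f z * deriv g z) (at z)"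
      by (auto intro!: derivative_eq_intros P' assms)
    then show ?thesis
      by (rule has_field_derivative_transform_within_open[where S = \<D>]) (use eq assms in auto)
  qed
qed

lemma volterra_in_hol_disc:
  assumes "g holomorphic_on \<D>" "f \<in> hol_disc"
  shows "volterra g f \<in> hol_disc"
proof -
  have "volterra g f holomorphic_on \<D>"
    using volterra_has_field_derivative[OF assms]
    by (meson holomorphic_onI field_differentiable_at_within field_differentiable_def)
  then show ?thesis by (simp add: hol_disc_def volterra_def)
qed

lemma linear_map_on_volterra:
  assumes g: "g holomorphic_on \<D>" and X: "X \<subseteq> hol_disc"
  shows "linear_map_on X (volterra g)"
  unfolding linear_map_on_def
proof (intro ballI allI ext)
  fix f h a b z assume fh: "f \<in> X" "h \<in> X"
  show "volterra g (\<lambda>z. a * f z + b * h z) z = a * volterra g f z + b * volterra g h z"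
  proof (cases "z \<in> \<D>")
    case True
    have seg: "closed_segment 0 z \<subseteq> \<D>" using True by (intro closed_segment_subset) auto
    have "(\<lambda>\<xi>. k \<xi> * deriv g \<xi>) contour_integrable_on linepath 0 z" if "k \<in> X" for k
    proof (rule contour_integrable_continuous_linepath)
      have "(\<lambda>\<xi>. k \<xi> * deriv g \<xi>) holomorphic_on \<D>"
        using that X g unfolding hol_disc_def by (intro holomorphic_intros) auto
      then show "continuous_on (closed_segment 0 z) (\<lambda>\<xi>. k \<xi> * deriv g \<xi>)"
        using seg holomorphic_on_imp_continuous_on continuous_on_subset by blast
    qed
    note int = this[OF fh(1)] this[OF fh(2)]
    have "((\<lambda>\<xi>. a * (f \<xi> * deriv g \<xi>) + b * (h \<xi> * deriv g \<xi>)) has_contour_integral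
       a * contour_integral (linepath 0 z) (\<lambda>\<xi>. f \<xi> * deriv g \<xi>)
       + b * contour_integral (linepath 0 z) (\<lambda>\<xi>. h \<xi> * deriv g \<xi>)) (linepath 0 z)"
      by (intro has_contour_integral_add has_contour_integral_lmul has_contour_integral_integral int)
    from contour_integral_unique[OF this] show ?thesis
      using True by (simp add: volterra_def algebra_simps)
  qed (simp add: volterra_def)
qed

lemma volterra_diff:
  assumes "g holomorphic_on \<D>" "f \<in> hol_disc" "h \<in> hol_disc"
  shows "volterra g (\<lambda>z. f z - h z) z = volterra g f z - volterra g h z"
proof -
  have "volterra g (\<lambda>z. 1 * f z + (- 1) * h z) = (\<lambda>z. 1 * volterra g f z + (- 1) * volterra g h z)"
    using linear_map_on_volterra[OF assms(1) order_refl] assms(2,3) unfolding linear_map_on_def by blast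
  from fun_cong[OF this, of z] show ?thesis by simp
qed

text \<open>
  On a smaller disc \<open>volterra g f\<close> is controlled by \<open>f\<close> on that disc. Applied to differences, this turns locally uniform
  convergence of functions into locally uniform convergence of their images.
\<close>
lemma volterra_small_on_cball:
  assumes g: "g holomorphic_on \<D>" and "0 \<le> s" "s < 1"
  shows "\<exists>L. \<forall>f a. f \<in> hol_disc \<and> (\<forall>w\<in>cball 0 s. norm (f w) \<le> a) \<longrightarrow>
    (\<forall>z\<in>cball 0 s. norm (volterra g f z) \<le> a * L)"
proof -
  have sub: "cball 0 s \<subseteq> \<D>" using assms by auto
  have "deriv g holomorphic_on \<D>" using g by (intro holomorphic_deriv) auto
  then have "continuous_on (cball 0 s) (deriv g)"
    by (rule continuous_on_subset[OF holomorphic_on_imp_continuous_on sub])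
  then have "compact (deriv g ` cball 0 s)" by (intro compact_continuous_image) auto
  from compact_imp_bounded[OF this] obtain L where "\<forall>x\<in>deriv g ` cball 0 s. norm x \<le> L"
    unfolding bounded_iff ..
  then have L: "norm (deriv g w) \<le> L" if "w \<in> cball 0 s" for w using that by blast
  have "norm (deriv g 0) \<le> L" using L[of 0] assms(2) by simp
  then have L0: "L \<ge> 0" using norm_ge_zero[of "deriv g 0"] by linarith
  have "norm (volterra g f z) \<le> a * L"
    if f: "f \<in> hol_disc" and a: "\<And>w. w \<in> cball 0 s \<Longrightarrow> norm (f w) \<le> a" and z: "z \<in> cball 0 s" for f a z
  proof -
    have "norm (f 0) \<le> a" using a[of 0] assms(2) by simp
    then have a0: "a \<ge> 0" using norm_ge_zero[of "f 0"] by linarith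
    have "norm (volterra g f z - volterra g f 0) \<le> a * L * norm (z - 0)"
    proof (rule field_differentiable_bound[where S = "cball 0 s" and f = "volterra g f"
          and f' = "\<lambda>w. f w * deriv g w" and x = z and y = 0])
      show "(volterra g f has_field_derivative f w * deriv g w) (at w within cball 0 s)" if "w \<in> cball 0 s" for w
        by (rule has_field_derivative_at_within[OF volterra_has_field_derivative[OF g f subsetD[OF sub that]]])
      show "norm (f w * deriv g w) \<le> a * L" if "w \<in> cball 0 s" for w
        unfolding norm_mult by (intro mult_mono a[OF that] L[OF that] a0 norm_ge_zero)
      show "0 \<in> cball (0::complex) s" using assms(2) by simp
    qed (simp_all only: z convex_cball)
    also have "\<dots> \<le> a * L * 1"
    proof (rule mult_left_mono)
      show "norm (z - 0) \<le> 1" using z assms(3) by simp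
    qed (intro mult_nonneg_nonneg a0 L0)
    finally show ?thesis by (simp add: volterra_0)
  qed
  then show ?thesis by (intro exI[of _ L] allI impI ballI) (simp only: Ball_def)
qed

lemma Hinf_norm_upper:
  assumes "f \<in> Hinf" "z \<in> \<D>" shows "norm (f z) \<le> Hinf_norm f"
proof -
  have "bdd_above ((\<lambda>z. norm (f z)) ` \<D>)"
    using assms(1) by (auto simp: Hinf_def bounded_iff bdd_above_def)
  then show ?thesis unfolding Hinf_norm_def using assms(2) by (rule cSUP_upper2) simp
qed

lemma Hinf_norm_least:
  assumes "\<And>z. z \<in> \<D> \<Longrightarrow> norm (f z) \<le> c" shows "Hinf_norm f \<le> c"
  unfolding Hinf_norm_def using assms by (intro cSUP_least) auto

lemma Hinf_diff:
  assumes "f \<in> Hinf" "h \<in> Hinf" shows "(\<lambda>z. f z - h z) \<in> Hinf"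
proof -
  have "bounded ((\<lambda>z. f z - h z) ` \<D>)"
    using assms bounded_minus_comp[of f \<D> h] by (simp add: Hinf_def)
  then show ?thesis using assms by (auto simp: Hinf_def hol_disc_def intro: holomorphic_intros)
qed

abbreviation weighted_unit_ball :: "real \<Rightarrow> (complex \<Rightarrow> complex) set" where
  "weighted_unit_ball \<alpha> \<equiv> {f \<in> Hinf_weighted \<alpha>. Hinf_weighted_norm \<alpha> f \<le> 1}"

lemma weighted_unit_ball_iff:
  "f \<in> weighted_unit_ball \<alpha> \<longleftrightarrow> f \<in> hol_disc \<and> (\<forall>z\<in>\<D>. std_weight \<alpha> z * norm (f z) \<le> 1)"
proof (intro iffI conjI ballI)
  assume f: "f \<in> weighted_unit_ball \<alpha>"
  then show "f \<in> hol_disc" by (simp add: Hinf_weighted_def)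
  fix z :: complex assume z: "z \<in> \<D>"
  have "bdd_above ((\<lambda>z. std_weight \<alpha> z * norm (f z)) ` \<D>)" using f by (simp add: Hinf_weighted_def)
  from cSUP_upper[OF z this] show "std_weight \<alpha> z * norm (f z) \<le> 1"
    using f by (simp add: Hinf_weighted_norm_def)
next
  assume f: "f \<in> hol_disc \<and> (\<forall>z\<in>\<D>. std_weight \<alpha> z * norm (f z) \<le> 1)"
  then have "bdd_above ((\<lambda>z. std_weight \<alpha> z * norm (f z)) ` \<D>)" by (intro bdd_aboveI2) blast
  moreover have "Hinf_weighted_norm \<alpha> f \<le> 1"
    unfolding Hinf_weighted_norm_def using f by (intro cSUP_least) auto
  ultimately show "f \<in> weighted_unit_ball \<alpha>" using f by (simp add: Hinf_weighted_def)
qed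

lemma weighted_unit_ball_bound:
  assumes "f \<in> weighted_unit_ball \<alpha>" "z \<in> \<D>"
  shows "norm (f z) \<le> 1 / std_weight \<alpha> z"
proof -
  have "std_weight \<alpha> z * norm (f z) \<le> 1" using assms unfolding weighted_unit_ball_iff by blast
  then show ?thesis using std_weight_pos[OF assms(2), of \<alpha>] by (simp add: field_simps)
qed

lemma weighted_unit_ball_locally_bounded:
  assumes "compact K" "K \<subseteq> \<D>"
  shows "\<exists>B. \<forall>f\<in>weighted_unit_ball \<alpha>. \<forall>z\<in>K. norm (f z) \<le> B"
proof -
  have "continuous_on K (\<lambda>z. 1 / std_weight \<alpha> z)"
  proof (intro continuous_intros ballI)
    show "continuous_on K (std_weight \<alpha>)"
      unfolding std_weight_def
    proof (intro continuous_intros ballI)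
      fix z assume "z \<in> K"
      then have "norm z < 1" using assms by auto
      then show "1 - (norm z)\<^sup>2 \<noteq> 0" using abs_square_eq_1[of "norm z"] by auto
    qed
    show "std_weight \<alpha> z \<noteq> 0" if "z \<in> K" for z using std_weight_pos[of z \<alpha>] assms that by fastforce
  qed
  then have "compact ((\<lambda>z. 1 / std_weight \<alpha> z) ` K)" using assms by (intro compact_continuous_image)
  from compact_imp_bounded[OF this] obtain B where "\<forall>x\<in>(\<lambda>z. 1 / std_weight \<alpha> z) ` K. norm x \<le> B"
    unfolding bounded_iff ..
  then have B: "\<bar>1 / std_weight \<alpha> z\<bar> \<le> B" if "z \<in> K" for z using that by force
  have "norm (f z) \<le> B" if "f \<in> weighted_unit_ball \<alpha>" "z \<in> K" for f z
  proof -
    have "norm (f z) \<le> 1 / std_weight \<alpha> z"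
      using assms(2) that(2) by (intro weighted_unit_ball_bound[OF that(1)]) auto
    also have "\<dots> \<le> B" using B[OF that(2)] by linarith
    finally show ?thesis .
  qed
  then show ?thesis by (intro exI[of _ B] ballI)
qed

section \<open>Integrals along radii\<close>

definition radial_density :: "(complex \<Rightarrow> complex) \<Rightarrow> real \<Rightarrow> real \<Rightarrow> real \<Rightarrow> real" where
  "radial_density g \<alpha> \<theta> r =
    norm (deriv g (of_real r * exp (\<i> * of_real \<theta>))) / (1 - r\<^sup>2) powr \<alpha>"

lemma radial_density_nonneg: "radial_density g \<alpha> \<theta> r \<ge> 0"
  by (simp add: radial_density_def)

lemma radial_point_in_disc:
  assumes "r \<in> {0..<1}" shows "of_real r * exp (\<i> * of_real \<theta>) \<in> \<D>"
  using assms by (simp add: norm_mult)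

lemma std_weight_radial: "std_weight \<alpha> (of_real r * exp (\<i> * of_real \<theta>)) = (1 - r\<^sup>2) powr \<alpha>"
  by (simp add: std_weight_def norm_mult)

lemma continuous_on_radial_density:
  assumes g: "g holomorphic_on \<D>" and A: "A \<subseteq> {0..<1}"
  shows "continuous_on A (radial_density g \<alpha> \<theta>)"
proof -
  have "deriv g holomorphic_on \<D>" using g by (intro holomorphic_deriv) auto
  then have "continuous_on \<D> (deriv g)" by (rule holomorphic_on_imp_continuous_on)
  then have 1: "continuous_on A (\<lambda>r. deriv g (of_real r * exp (\<i> * of_real \<theta>)))"
  proof (rule continuous_on_compose2)
    show "continuous_on A (\<lambda>r. of_real r * exp (\<i> * of_real \<theta>))" by (intro continuous_intros)
    show "(\<lambda>r. of_real r * exp (\<i> * of_real \<theta>)) ` A \<subseteq> \<D>"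
      using radial_point_in_disc A by blast
  qed
  have 2: "1 - r\<^sup>2 > 0" if "r \<in> A" for r :: real
  proof -
    have "0 \<le> r" "r < 1" using that A by auto
    then show ?thesis by (simp add: power_less_one_iff)
  qed
  show ?thesis unfolding radial_density_def
  proof (intro continuous_on_divide continuous_on_norm 1 continuous_on_powr continuous_intros ballI)
    show "1 - r\<^sup>2 \<noteq> 0" if "r \<in> A" for r using 2[OF that] by simp
    show "(1 - r\<^sup>2) powr \<alpha> \<noteq> 0" if "r \<in> A" for r using 2[OF that] by simp
  qed
qed

lemma radial_density_integrable:
  assumes "g holomorphic_on \<D>" "0 \<le> s" "R < 1"
  shows "radial_density g \<alpha> \<theta> integrable_on {s..R}"
  by (rule integrable_continuous_interval[OF continuous_on_radial_density]) (use assms in auto)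

lemma volterra_has_radial_integral:
  fixes \<theta> :: real
  assumes g: "g holomorphic_on \<D>" and f: "f \<in> hol_disc" and R: "0 \<le> s" "s \<le> R" "R < 1"
  defines "e \<equiv> exp (\<i> * of_real \<theta>)"
  shows "((\<lambda>r. f (of_real r * e) * deriv g (of_real r * e) * e) has_integral
    volterra g f (of_real R * e) - volterra g f (of_real s * e)) {s..R}"
proof (rule fundamental_theorem_of_calculus[OF R(2)])
  fix r assume r: "r \<in> {s..R}"
  have rD: "of_real r * e \<in> \<D>" unfolding e_def using r R by (intro radial_point_in_disc) auto
  have 1: "((\<lambda>r. of_real r * e) has_vector_derivative e) (at r within {s..R})"
    by (auto intro!: derivative_eq_intros)
  have "(volterra g f has_field_derivative f (of_real r * e) * deriv g (of_real r * e))
     (at (of_real r * e) within (\<lambda>r. of_real r * e) ` {s..R})"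
    by (rule has_field_derivative_at_within[OF volterra_has_field_derivative[OF g f rD]])
  from field_vector_diff_chain_within[OF 1 this]
  show "((\<lambda>r. volterra g f (of_real r * e)) has_vector_derivative
     f (of_real r * e) * deriv g (of_real r * e) * e) (at r within {s..R})"
    by (simp add: o_def mult_ac)
qed

text \<open>
  The tail starts at \<open>t < s\<close>, so that the closed interval \<open>{s..R}\<close> lies inside the open one.
\<close>
lemma volterra_radial_increment_bound:
  fixes \<theta> :: real
  assumes g: "g holomorphic_on \<D>" and f: "f \<in> hol_disc"
    and K: "\<And>z. z \<in> \<D> \<Longrightarrow> std_weight \<alpha> z * norm (f z) \<le> K" and K0: "0 \<le> K"
    and R: "0 \<le> t" "t < s" "s \<le> R" "R < 1"
    and tail: "(\<integral>\<^sup>+ r\<in>{t<..<1}. ennreal (radial_density g \<alpha> \<theta> r) \<partial>lborel) \<le> ennreal \<epsilon>" and \<epsilon>: "0 \<le> \<epsilon>"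
  defines "e \<equiv> exp (\<i> * of_real \<theta>)"
  shows "norm (volterra g f (of_real R * e) - volterra g f (of_real s * e)) \<le> K * \<epsilon>"
proof -
  define q where "q = radial_density g \<alpha> \<theta>"
  have s: "0 \<le> s" using R by simp
  have int: "q integrable_on {s..R}" unfolding q_def by (rule radial_density_integrable[OF g s R(4)])
  have "ennreal (integral {s..R} q) = (\<integral>\<^sup>+ r\<in>{s..R}. ennreal (q r) \<partial>lborel)"
    by (rule nn_integral_has_integral_lebesgue'[symmetric, OF _ integrable_integral[OF int]])
      (simp add: q_def radial_density_nonneg)
  also have "\<dots> \<le> (\<integral>\<^sup>+ r\<in>{t<..<1}. ennreal (q r) \<partial>lborel)"
    using R by (intro nn_integral_mono mult_left_mono) (auto simp: indicator_def)
  also have "\<dots> \<le> ennreal \<epsilon>" using tail by (simp add: q_def)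
  finally have q\<epsilon>: "integral {s..R} q \<le> \<epsilon>" using \<epsilon> by (simp add: ennreal_le_iff)
  note I = volterra_has_radial_integral[OF g f s R(3,4), of \<theta>, folded e_def]
  have "norm (integral {s..R} (\<lambda>r. f (of_real r * e) * deriv g (of_real r * e) * e)) \<le> integral {s..R} (\<lambda>r. K * q r)"
  proof (rule integral_norm_bound_integral)
    show "(\<lambda>r. f (of_real r * e) * deriv g (of_real r * e) * e) integrable_on {s..R}"
      by (rule has_integral_integrable[OF I])
    show "(\<lambda>r. K * q r) integrable_on {s..R}" by (rule integrable_on_mult_right[OF int])
    show "norm (f (of_real r * e) * deriv g (of_real r * e) * e) \<le> K * q r" if "r \<in> {s..R}" for r
    proof -
      have rD: "of_real r * e \<in> \<D>" unfolding e_def using that R by (intro radial_point_in_disc) auto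
      have w: "std_weight \<alpha> (of_real r * e) = (1 - r\<^sup>2) powr \<alpha>" unfolding e_def by (rule std_weight_radial)
      have "norm (f (of_real r * e)) \<le> K / (1 - r\<^sup>2) powr \<alpha>"
        using K[OF rD] std_weight_pos[OF rD, of \<alpha>] unfolding w by (simp add: pos_le_divide_eq mult.commute)
      then have "norm (f (of_real r * e)) * norm (deriv g (of_real r * e))
         \<le> K / (1 - r\<^sup>2) powr \<alpha> * norm (deriv g (of_real r * e))" by (rule mult_right_mono) simp
      also have "\<dots> = K * q r" by (simp add: q_def radial_density_def e_def)
      finally show ?thesis by (simp add: norm_mult e_def)
    qed
  qed
  also have "\<dots> = K * integral {s..R} q" by (rule integral_mult_right)
  also have "\<dots> \<le> K * \<epsilon>" using q\<epsilon> K0 by (rule mult_left_mono)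
  finally show ?thesis unfolding integral_unique[OF I] .
qed

text \<open>
  Every point outside the disc of radius \<open>s\<close> is joined radially to a point of its boundary.
\<close>
lemma volterra_bound_from_radial_tails:
  assumes g: "g holomorphic_on \<D>" and f: "f \<in> hol_disc"
    and K: "\<And>z. z \<in> \<D> \<Longrightarrow> std_weight \<alpha> z * norm (f z) \<le> K" and K0: "0 \<le> K"
    and t: "0 \<le> t" "t < s" "s < 1"
    and tail: "\<And>\<theta>. \<theta> \<in> {0..<2 * pi} \<Longrightarrow>
      (\<integral>\<^sup>+ r\<in>{t<..<1}. ennreal (radial_density g \<alpha> \<theta> r) \<partial>lborel) \<le> ennreal \<epsilon>" and \<epsilon>: "0 \<le> \<epsilon>"
    and \<delta>: "\<And>z. z \<in> cball 0 s \<Longrightarrow> norm (volterra g f z) \<le> \<delta>"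
    and z: "z \<in> \<D>"
  shows "norm (volterra g f z) \<le> \<delta> + K * \<epsilon>"
proof (cases "norm z \<le> s")
  case True
  then have "norm (volterra g f z) \<le> \<delta>" by (intro \<delta>) simp
  moreover have "0 \<le> K * \<epsilon>" by (intro mult_nonneg_nonneg K0 \<epsilon>)
  ultimately show ?thesis by linarith
next
  case False
  define \<theta> where "\<theta> = Arg2pi z"
  have z_eq: "z = of_real (norm z) * exp (\<i> * of_real \<theta>)"
    unfolding \<theta>_def by (rule Arg2pi_eq)
  have \<theta>: "\<theta> \<in> {0..<2 * pi}" using Arg2pi_ge_0[of z] Arg2pi_lt_2pi[of z] by (simp add: \<theta>_def)
  have R: "s \<le> norm z" "norm z < 1" using False z by auto
  have "norm (volterra g f z - volterra g f (of_real s * exp (\<i> * of_real \<theta>))) \<le> K * \<epsilon>"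
    using volterra_radial_increment_bound[OF g f K K0 t(1,2) R tail[OF \<theta>] \<epsilon>] z_eq by simp
  moreover have "norm (volterra g f (of_real s * exp (\<i> * of_real \<theta>))) \<le> \<delta>"
    using t by (intro \<delta>) (simp add: norm_mult)
  ultimately show ?thesis
    using norm_triangle_sub[of "volterra g f z" "volterra g f (of_real s * exp (\<i> * of_real \<theta>))"] by linarith
qed

text \<open>
  Monotone convergence along intervals ending at \<open>1 - (1 - t) / (n + 1)\<close>. This is how estimates on segments of a radius
  that end before the unit circle reach the circle.
\<close>
lemma nn_integral_Ioo_le_if_Icc_le:
  fixes q :: "real \<Rightarrow> real"
  assumes cont: "continuous_on {t..<1} q" and q0: "\<And>r. 0 \<le> q r" and t: "t < 1"
    and B: "\<And>R. \<lbrakk>t \<le> R; R < 1\<rbrakk> \<Longrightarrow> integral {t..R} q \<le> B"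
  shows "(\<integral>\<^sup>+ r\<in>{t<..<1}. ennreal (q r) \<partial>lborel) \<le> ennreal B"
proof -
  define R where "R = (\<lambda>n. 1 - (1 - t) / (real n + 1))"
  have Rt: "t \<le> R n" "R n < 1" for n
  proof -
    have "(1 - t) / (real n + 1) \<le> (1 - t) / 1" using t by (intro divide_left_mono) auto
    then show "t \<le> R n" by (simp add: R_def)
    show "R n < 1" using t by (simp add: R_def)
  qed
  have Rmono: "R m \<le> R n" if "m \<le> n" for m n
    unfolding R_def using t that by (intro diff_left_mono divide_left_mono) auto
  define F where "F = (\<lambda>n r. ennreal (q r) * indicator {t..R n} r)"
  have cR: "continuous_on {t..R n} q" for n
    using cont by (rule continuous_on_subset) (use Rt[of n] in auto)
  have meas: "F n \<in> borel_measurable lborel" for n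
  proof -
    have "(\<lambda>r. indicator {t..R n} r *\<^sub>R q r) \<in> borel_measurable borel"
      by (rule borel_measurable_continuous_on_indicator[OF _ cR]) simp
    then have "(\<lambda>r. ennreal (indicator {t..R n} r *\<^sub>R q r)) \<in> borel_measurable borel"
      by measurable
    moreover have "(\<lambda>r. ennreal (indicator {t..R n} r *\<^sub>R q r)) = F n"
      by (auto simp: F_def indicator_def)
    ultimately show ?thesis by simp
  qed
  have inc: "incseq F"
    using Rmono by (auto simp: F_def incseq_def le_fun_def indicator_def intro: order_trans)
  have le: "integral\<^sup>N lborel (F n) \<le> ennreal B" for n
  proof -
    have "integral\<^sup>N lborel (F n) = ennreal (integral {t..R n} q)"
      unfolding F_def
      by (rule nn_integral_has_integral_lebesgue'[OF q0 integrable_integral[OF integrable_continuous_interval[OF cR]]])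
    also have "\<dots> \<le> ennreal B" by (rule ennreal_leI[OF B[OF Rt]])
    finally show ?thesis .
  qed
  have "(\<integral>\<^sup>+ r\<in>{t<..<1}. ennreal (q r) \<partial>lborel) \<le> (\<integral>\<^sup>+ r. (SUP n. F n r) \<partial>lborel)"
  proof (rule nn_integral_mono)
    fix r :: real
    show "ennreal (q r) * indicator {t<..<1} r \<le> (SUP n. F n r)"
    proof (cases "r \<in> {t<..<1}")
      case True
      obtain n where n: "(1 - t) / (1 - r) < real n" using reals_Archimedean2 by blast
      have "(1 - t) / (real n + 1) \<le> 1 - r"
      proof -
        have "1 - t < real n * (1 - r)" using n True by (simp add: pos_divide_less_eq)
        also have "\<dots> \<le> (real n + 1) * (1 - r)" using True by (intro mult_right_mono) auto
        finally show ?thesis by (simp add: pos_divide_le_eq mult.commute)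
      qed
      then have "ennreal (q r) * indicator {t<..<1} r = F n r" using True by (simp add: F_def R_def)
      also have "\<dots> \<le> (SUP n. F n r)" by (rule SUP_upper) simp
      finally show ?thesis .
    qed simp
  qed
  also have "\<dots> = (SUP n. integral\<^sup>N lborel (F n))"
    by (rule nn_integral_monotone_convergence_SUP[OF inc meas])
  also have "\<dots> \<le> ennreal B" by (rule SUP_least) (rule le)
  finally show ?thesis .
qed

section \<open>Compactness forces small radial tails\<close>

text \<open>
  After rotating the radius to the real one, the test function is the phase-cancelling function times
  \<open>(1 - z\<^sup>2) powr (- \<alpha>)\<close>. That factor equals \<open>(1 - r\<^sup>2) powr (- \<alpha>)\<close> on the radius, and since
  \<open>1 - (norm z)\<^sup>2 \<le> norm (1 - z\<^sup>2)\<close> it is compensated by the weight on the whole disc.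
\<close>
lemma radial_test_functions:
  assumes g: "g holomorphic_on \<D>" and inj: "inj_on g \<D>" and \<alpha>: "0 \<le> \<alpha>"
  shows "\<exists>c>0. \<forall>\<theta> R. 0 \<le> R \<and> R < 1 \<longrightarrow> (\<exists>f\<in>weighted_unit_ball \<alpha>. \<forall>r\<in>{0..R}.
    c * radial_density g \<alpha> \<theta> r \<le>
      Re (f (of_real r * exp (\<i> * of_real \<theta>)) * deriv g (of_real r * exp (\<i> * of_real \<theta>)) * exp (\<i> * of_real \<theta>)))"
proof -
  obtain M where M: "\<forall>f R. f holomorphic_on \<D> \<and> inj_on f \<D> \<and> 0 \<le> R \<and> R < 1 \<longrightarrow>
     (\<exists>p. p holomorphic_on \<D> \<and> (\<forall>z\<in>\<D>. norm (p z) \<le> M) \<and>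
       (\<forall>r\<in>{0..R}. cos 1 * norm (deriv f (of_real r)) \<le> Re (p (of_real r) * deriv f (of_real r))))"
    using univalent_phase_cancelling_function ..
  define M' where "M' = max M 1"
  have M': "M' > 0" "M \<le> M'" by (auto simp: M'_def)
  have cos1: "cos (1::real) > 0" using pi_gt3 by (intro cos_gt_zero) auto
  show ?thesis
  proof (intro exI[of _ "cos 1 / M'"] conjI allI impI)
    show "cos 1 / M' > 0" using cos1 M' by simp
    fix \<theta> R :: real assume R: "0 \<le> R \<and> R < 1"
    define e where "e = exp (\<i> * of_real \<theta>)"
    define e' where "e' = exp (- (\<i> * of_real \<theta>))"
    have ee: "e' * e = 1" unfolding e_def e'_def by (simp flip: exp_add)
    have ne: "norm e = 1" "norm e' = 1" by (simp_all add: e_def e'_def)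
    have inD: "e * z \<in> \<D>" "e' * z \<in> \<D>" if "z \<in> \<D>" for z using that ne by (simp_all add: norm_mult)
    define G where "G = (\<lambda>z. g (e * z))"
    have dG: "(G has_field_derivative e * deriv g (e * z)) (at z)" if z: "z \<in> \<D>" for z
    proof -
      have 1: "(g has_field_derivative deriv g (e * z)) (at (e * z))"
        by (rule holomorphic_derivI[OF g open_ball inD(1)[OF z]])
      have 2: "((\<lambda>z. e * z) has_field_derivative e) (at z)" by (auto intro!: derivative_eq_intros)
      show ?thesis unfolding G_def using DERIV_chain2[OF 1 2] by (simp add: mult.commute)
    qed
    have holG: "G holomorphic_on \<D>" using dG
      by (meson holomorphic_onI field_differentiable_at_within field_differentiable_def)
    have injG: "inj_on G \<D>"
    proof (rule inj_onI)
      fix x y assume xy: "x \<in> \<D>" "y \<in> \<D>" "G x = G y"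
      then have "e * x = e * y" using inj_onD[OF inj, of "e * x" "e * y"] inD by (simp add: G_def)
      then show "x = y" using ne by auto
    qed
    obtain p where p: "p holomorphic_on \<D>" "\<forall>z\<in>\<D>. norm (p z) \<le> M"
      "\<forall>r\<in>{0..R}. cos 1 * norm (deriv G (of_real r)) \<le> Re (p (of_real r) * deriv G (of_real r))"
      using M[rule_format, of G R] holG injG R by blast
    \<comment> \<open>\<open>1 - z\<^sup>2\<close> lies in the right half-plane, so the principal logarithm gives an analytic power.\<close>
    define k where "k = (\<lambda>z. exp (- (of_real \<alpha> * Ln (1 - z\<^sup>2))))"
    have Re1: "1 - (norm z)\<^sup>2 > 0" "1 - (norm z)\<^sup>2 \<le> norm (1 - z\<^sup>2)" "Re (1 - z\<^sup>2) > 0"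
      if "z \<in> \<D>" for z :: complex
    proof -
      have "norm z < 1" using that by simp
      then show 1: "1 - (norm z)\<^sup>2 > 0" by (simp add: power_less_one_iff)
      show "1 - (norm z)\<^sup>2 \<le> norm (1 - z\<^sup>2)"
        using norm_triangle_ineq2[of 1 "z\<^sup>2"] by (simp add: norm_power)
      have "Re (z\<^sup>2) \<le> (norm z)\<^sup>2" using complex_Re_le_cmod[of "z\<^sup>2"] by (simp only: norm_power)
      then show "Re (1 - z\<^sup>2) > 0" using 1 by simp
    qed
    have holk: "k holomorphic_on \<D>"
      unfolding k_def
    proof (intro holomorphic_intros)
      show "1 - z\<^sup>2 \<notin> \<real>\<^sub>\<le>\<^sub>0" if "z \<in> \<D>" for z
        using Re1(3)[OF that] complex_nonpos_Reals_iff[of "1 - z\<^sup>2"] by linarith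
    qed
    have nk: "(1 - (norm z)\<^sup>2) powr \<alpha> * norm (k z) \<le> 1" if "z \<in> \<D>" for z
    proof -
      define x y where "x = 1 - (norm z)\<^sup>2" and "y = norm (1 - z\<^sup>2)"
      have xy: "x > 0" "x \<le> y" using Re1[OF that] by (auto simp: x_def y_def)
      have nz: "1 - z\<^sup>2 \<noteq> 0" using Re1(3)[OF that] by force
      have "norm (k z) = exp (- (\<alpha> * ln y))" using nz by (simp add: k_def y_def)
      then have "x powr \<alpha> * norm (k z) = exp (\<alpha> * ln x - \<alpha> * ln y)"
        using xy by (simp add: powr_def exp_diff exp_minus field_simps)
      moreover have "\<alpha> * ln x \<le> \<alpha> * ln y" using xy \<alpha> by (intro mult_left_mono) auto
      ultimately show ?thesis by (simp add: x_def)
    qed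
    define f where "f = (\<lambda>z. if z \<in> \<D> then p (e' * z) * k (e' * z) / of_real M' else 0)"
    have holf: "f holomorphic_on \<D>"
    proof -
      have c: "(\<lambda>z. h (e' * z)) holomorphic_on \<D>" if "h holomorphic_on \<D>" for h
        by (rule holomorphic_on_compose_gen[of "\<lambda>z. e' * z" \<D> h \<D>, unfolded o_def])
          (use inD that in \<open>auto intro!: holomorphic_intros\<close>)
      have "(\<lambda>z. p (e' * z) * k (e' * z) / of_real M') holomorphic_on \<D>"
        using M' by (intro holomorphic_intros c p holk) auto
      then show ?thesis by (rule holomorphic_transform) (simp add: f_def)
    qed
    have fball: "f \<in> weighted_unit_ball \<alpha>"
      unfolding weighted_unit_ball_iff
    proof (intro conjI ballI)
      show "f \<in> hol_disc" using holf by (simp add: hol_disc_def f_def)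
      fix z assume z: "z \<in> \<D>"
      have a: "(1 - (norm z)\<^sup>2) powr \<alpha> * norm (k (e' * z)) \<le> 1"
        using nk[OF inD(2)[OF z]] ne by (simp add: norm_mult)
      have "norm (p (e' * z)) \<le> M" by (rule p(2)[rule_format, OF inD(2)[OF z]])
      then have b: "norm (p (e' * z)) / M' \<le> 1" using M' by (simp add: pos_divide_le_eq)
      have "std_weight \<alpha> z * norm (f z) = (norm (p (e' * z)) / M') * ((1 - (norm z)\<^sup>2) powr \<alpha> * norm (k (e' * z)))"
        unfolding std_weight_def f_def using z M' by (simp add: norm_mult norm_divide)
      also have "\<dots> \<le> 1 * 1" by (rule mult_mono[OF b a]) auto
      finally show "std_weight \<alpha> z * norm (f z) \<le> 1" by simp
    qed
    have "cos 1 / M' * radial_density g \<alpha> \<theta> r \<le> Re (f (of_real r * e) * deriv g (of_real r * e) * e)"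
      if r: "r \<in> {0..R}" for r
    proof -
      have r1: "of_real r \<in> \<D>" "of_real r * e \<in> \<D>" using r R ne by (auto simp: norm_mult)
      have r2: "1 - r\<^sup>2 > 0" using Re1(1)[OF r1(1)] by simp
      have er: "e' * (of_real r * e) = of_real r" using ee by (simp add: mult_ac)
      have kr: "k (of_real r) = of_real (1 / (1 - r\<^sup>2) powr \<alpha>)"
      proof -
        have "Ln (1 - (of_real r)\<^sup>2) = of_real (ln (1 - r\<^sup>2))"
          using Ln_of_real[OF r2] by simp
        then have "k (of_real r) = exp (of_real (- (\<alpha> * ln (1 - r\<^sup>2))))" by (simp add: k_def)
        also have "\<dots> = of_real (exp (- (\<alpha> * ln (1 - r\<^sup>2))))" by (rule exp_of_real)
        also have "exp (- (\<alpha> * ln (1 - r\<^sup>2))) = 1 / (1 - r\<^sup>2) powr \<alpha>"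
          using r2 by (simp add: powr_def exp_minus divide_inverse)
        finally show ?thesis .
      qed
      have dGr: "deriv G (of_real r) = e * deriv g (e * of_real r)" by (rule DERIV_imp_deriv[OF dG[OF r1(1)]])
      have "f (of_real r * e) * deriv g (of_real r * e) * e
         = of_real (1 / (1 - r\<^sup>2) powr \<alpha> / M') * (p (of_real r) * deriv G (of_real r))"
      proof -
        have "f (of_real r * e) = p (of_real r) * of_real (1 / (1 - r\<^sup>2) powr \<alpha>) / of_real M'"
          unfolding f_def er kr using r1(2) by simp
        then show ?thesis unfolding dGr by (simp add: mult_ac)
      qed
      then have "Re (f (of_real r * e) * deriv g (of_real r * e) * e)
         = 1 / (1 - r\<^sup>2) powr \<alpha> / M' * Re (p (of_real r) * deriv G (of_real r))"
        by (simp only: Re_complex_of_real Im_complex_of_real times_complex.simps mult_zero_left diff_zero)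
      also have "\<dots> \<ge> 1 / (1 - r\<^sup>2) powr \<alpha> / M' * (cos 1 * norm (deriv G (of_real r)))"
        using p(3) r M' by (intro mult_left_mono) auto
      also have "1 / (1 - r\<^sup>2) powr \<alpha> / M' * (cos 1 * norm (deriv G (of_real r))) = cos 1 / M' * radial_density g \<alpha> \<theta> r"
        unfolding dGr radial_density_def e_def[symmetric] using ne by (simp add: norm_mult mult.commute)
      finally show ?thesis .
    qed
    then show "\<exists>f\<in>weighted_unit_ball \<alpha>. \<forall>r\<in>{0..R}. cos 1 / M' * radial_density g \<alpha> \<theta> r \<le>
      Re (f (of_real r * exp (\<i> * of_real \<theta>)) * deriv g (of_real r * exp (\<i> * of_real \<theta>)) * exp (\<i> * of_real \<theta>))"
      unfolding e_def[symmetric] using fball by (intro bexI[of _ f] ballI)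
  qed
qed

lemma power_mult_in_weighted_unit_ball:
  assumes "f \<in> weighted_unit_ball \<alpha>"
  shows "(\<lambda>z. z ^ m * f z) \<in> weighted_unit_ball \<alpha>"
  unfolding weighted_unit_ball_iff
proof (intro conjI ballI)
  have f: "f \<in> hol_disc" "\<forall>z\<in>\<D>. std_weight \<alpha> z * norm (f z) \<le> 1"
    using assms unfolding weighted_unit_ball_iff by blast+
  then show "(\<lambda>z. z ^ m * f z) \<in> hol_disc" by (auto simp: hol_disc_def intro!: holomorphic_intros)
  fix z :: complex assume z: "z \<in> \<D>"
  have "norm z ^ m \<le> 1" using z by (intro power_le_one) auto
  then have "norm z ^ m * (std_weight \<alpha> z * norm (f z)) \<le> 1 * 1"
    using f(2) z std_weight_pos[OF z, of \<alpha>] by (intro mult_mono) auto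
  then show "std_weight \<alpha> z * norm (z ^ m * f z) \<le> 1" by (simp add: norm_mult norm_power mult_ac)
qed

text \<open>
  The test function for the segment up to \<open>R\<close>, multiplied by \<open>z ^ m\<close>, is inserted into the operator. Beyond \<open>t\<close> the factor
  \<open>r ^ m\<close> costs at most \<open>t ^ m\<close>, and the increment of the image between \<open>t\<close> and \<open>R\<close> is at most \<open>2 \<epsilon>\<close>.
\<close>
lemma radial_tail_le_volterra:
  assumes g: "g holomorphic_on \<D>" and inj: "inj_on g \<D>" and \<alpha>: "0 \<le> \<alpha>"
  shows "\<exists>C>0. \<forall>m \<epsilon> \<theta> t. 0 < t \<and> t < 1 \<and>
    (\<forall>f\<in>weighted_unit_ball \<alpha>. \<forall>z\<in>\<D>. norm (volterra g (\<lambda>z. z ^ m * f z) z) \<le> \<epsilon>) \<longrightarrow>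
    (\<integral>\<^sup>+ r\<in>{t<..<1}. ennreal (radial_density g \<alpha> \<theta> r) \<partial>lborel) \<le> ennreal (C * \<epsilon> / t ^ m)"
proof -
  obtain c where c: "c > 0" and test: "\<forall>\<theta> R. 0 \<le> R \<and> R < 1 \<longrightarrow> (\<exists>f\<in>weighted_unit_ball \<alpha>. \<forall>r\<in>{0..R}.
    c * radial_density g \<alpha> \<theta> r \<le>
      Re (f (of_real r * exp (\<i> * of_real \<theta>)) * deriv g (of_real r * exp (\<i> * of_real \<theta>)) * exp (\<i> * of_real \<theta>)))"
    using radial_test_functions[OF assms] by (elim exE conjE)
  show ?thesis
  proof (intro exI[of _ "2 / c"] conjI allI impI, goal_cases)
    case 1 then show ?case using c by simp
  next
    case (2 m \<epsilon> \<theta> t)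
    then have t: "0 < t" "t < 1" and
      small: "\<And>f z. \<lbrakk>f \<in> weighted_unit_ball \<alpha>; z \<in> \<D>\<rbrakk> \<Longrightarrow> norm (volterra g (\<lambda>z. z ^ m * f z) z) \<le> \<epsilon>"
      by (elim conjE; assumption | blast)+
    define e where "e = exp (\<i> * of_real \<theta>)"
    have ne: "norm e = 1" by (simp add: e_def)
    define q where "q = radial_density g \<alpha> \<theta>"
    show ?case
      unfolding q_def[symmetric]
    proof (rule nn_integral_Ioo_le_if_Icc_le[OF _ _ t(2)])
      show "continuous_on {t..<1} q"
        unfolding q_def by (rule continuous_on_radial_density[OF g]) (use t in auto)
      show "0 \<le> q r" for r unfolding q_def by (rule radial_density_nonneg)
      fix R assume R: "t \<le> R" "R < 1"
      obtain f where f: "f \<in> weighted_unit_ball \<alpha>" and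
        fr: "\<forall>r\<in>{0..R}. c * q r \<le> Re (f (of_real r * e) * deriv g (of_real r * e) * e)"
        using test[rule_format, of R \<theta>] R t unfolding q_def e_def by auto
      define h where "h = (\<lambda>z. z ^ m * f z)"
      have h: "h \<in> hol_disc"
        using power_mult_in_weighted_unit_ball[OF f, of m] unfolding weighted_unit_ball_iff h_def by blast
      define D where "D = volterra g h (of_real R * e) - volterra g h (of_real t * e)"
      \<comment> \<open>The factor \<open>z ^ m\<close> adds the constant phase \<open>e ^ m\<close> on the ray, which is removed again.\<close>
      have "((\<lambda>r. h (of_real r * e) * deriv g (of_real r * e) * e) has_integral D) {t..R}"
        unfolding D_def e_def using volterra_has_radial_integral[OF g h _ R] t by simp
      then have "((\<lambda>r. cnj e ^ m * (h (of_real r * e) * deriv g (of_real r * e) * e)) has_integral cnj e ^ m * D) {t..R}"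
        by (rule has_integral_mult_right)
      from has_integral_Re[OF this]
      have I: "((\<lambda>r. Re (cnj e ^ m * (h (of_real r * e) * deriv g (of_real r * e) * e))) has_integral Re (cnj e ^ m * D)) {t..R}" .
      have J: "((\<lambda>r. t ^ m * c * q r) has_integral t ^ m * c * integral {t..R} q) {t..R}"
        unfolding q_def using t R
        by (intro has_integral_mult_right integrable_integral radial_density_integrable[OF g]) auto
      have "t ^ m * c * integral {t..R} q \<le> Re (cnj e ^ m * D)"
      proof (rule has_integral_le[OF J I])
        fix r assume r: "r \<in> {t..R}"
        have "cnj e * e = 1" using complex_norm_square[of e] ne by (simp add: mult.commute)
        then have phase: "cnj e * (of_real r * e) = of_real r" by (simp add: mult.left_commute)
        have ph: "cnj e ^ m * (of_real r * e) ^ m = of_real (r ^ m)"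
          unfolding power_mult_distrib[symmetric] phase by simp
        have "cnj e ^ m * (h (of_real r * e) * deriv g (of_real r * e) * e)
          = of_real (r ^ m) * (f (of_real r * e) * deriv g (of_real r * e) * e)"
          unfolding ph[symmetric] h_def by (simp only: mult_ac)
        then have "Re (cnj e ^ m * (h (of_real r * e) * deriv g (of_real r * e) * e))
          = r ^ m * Re (f (of_real r * e) * deriv g (of_real r * e) * e)"
          by (simp only: Re_complex_of_real Im_complex_of_real times_complex.simps mult_zero_left diff_zero)
        moreover have "r ^ m * Re (f (of_real r * e) * deriv g (of_real r * e) * e) \<ge> r ^ m * (c * q r)"
          using fr r t by (intro mult_left_mono) auto
        moreover have "r ^ m * (c * q r) \<ge> t ^ m * (c * q r)"
          using r t c radial_density_nonneg[of g \<alpha> \<theta> r]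
          by (intro mult_right_mono power_mono mult_nonneg_nonneg) (auto simp: q_def)
        ultimately show "t ^ m * c * q r \<le> Re (cnj e ^ m * (h (of_real r * e) * deriv g (of_real r * e) * e))"
          by (simp add: mult.assoc)
      qed
      also have "\<dots> \<le> norm (cnj e ^ m * D)" by (rule complex_Re_le_cmod)
      also have "\<dots> = norm D" by (simp add: norm_mult norm_power ne)
      also have "\<dots> \<le> \<epsilon> + \<epsilon>"
        unfolding D_def
      proof (rule order_trans[OF norm_triangle_ineq4 add_mono])
        show "norm (volterra g h (of_real R * e)) \<le> \<epsilon>" unfolding h_def
          by (rule small[OF f]) (use R t ne in \<open>simp add: norm_mult\<close>)
        show "norm (volterra g h (of_real t * e)) \<le> \<epsilon>" unfolding h_def
          by (rule small[OF f]) (use R t ne in \<open>simp add: norm_mult\<close>)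
      qed
      finally have le: "t ^ m * c * integral {t..R} q \<le> 2 * \<epsilon>" by simp
      have tc: "t ^ m * c > 0" using t c by simp
      have "integral {t..R} q \<le> 2 * \<epsilon> / (t ^ m * c)"
        using le tc by (simp add: pos_le_divide_eq mult.commute)
      also have "\<dots> = 2 / c * \<epsilon> / t ^ m" by (simp add: mult.commute)
      finally show "integral {t..R} q \<le> 2 / c * \<epsilon> / t ^ m" .
    qed
  qed
qed

lemma norm_dist_Hinf_upper:
  assumes "f \<in> Hinf" "h \<in> Hinf" "z \<in> \<D>"
  shows "norm (f z - h z) \<le> norm_dist Hinf Hinf_norm f h"
  using Hinf_norm_upper[OF Hinf_diff[OF assms(1,2)] assms(3)] assms(1,2) by (simp add: norm_dist_def)

text \<open>
  Otherwise there are functions \<open>z ^ m f\<^sub>m\<close> in the unit ball whose images all have norm greater than \<open>\<epsilon>\<close>. By compactness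
  some of the images converge in norm. As \<open>z ^ m f\<^sub>m\<close> tends to 0 locally uniformly, so do the images, and hence the limit
  in norm is 0.
\<close>
lemma compact_volterra_small_on_high_powers:
  assumes g: "g holomorphic_on \<D>" and \<epsilon>: "\<epsilon> > 0"
    and T: "compact_operator (Hinf_weighted \<alpha>) (Hinf_weighted_norm \<alpha>) Hinf Hinf_norm (volterra g)"
  shows "\<exists>m. \<forall>f\<in>weighted_unit_ball \<alpha>. \<forall>z\<in>\<D>. norm (volterra g (\<lambda>z. z ^ m * f z) z) \<le> \<epsilon>"
proof (rule ccontr)
  define P where "P = (\<lambda>m f z. f \<in> weighted_unit_ball \<alpha> \<and> z \<in> \<D> \<and>
    \<epsilon> < norm (volterra g (\<lambda>z. z ^ m * f z) z))"
  assume "\<not> ?thesis"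
  then have "\<exists>f z. P m f z" for m unfolding P_def not_ex not_all Ball_def not_imp not_le by blast
  then have "\<forall>m. \<exists>x. P m (fst x) (snd x)" by simp
  from choice[OF this] obtain x where x: "\<forall>m. P m (fst (x m)) (snd (x m))" ..
  define f \<zeta> where "f = (\<lambda>m. fst (x m))" and "\<zeta> = (\<lambda>m. snd (x m))"
  have "P m (f m) (\<zeta> m)" for m using x by (simp add: f_def \<zeta>_def)
  then have f: "f m \<in> weighted_unit_ball \<alpha>" and \<zeta>: "\<zeta> m \<in> \<D>"
    and big: "\<epsilon> < norm (volterra g (\<lambda>z. z ^ m * f m z) (\<zeta> m))" for m
    unfolding P_def by blast+
  interpret H: Metric_space Hinf "norm_dist Hinf Hinf_norm" by (rule Metric_space_Hinf)
  define h where "h = (\<lambda>m z. z ^ m * f m z)"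
  define \<sigma> where "\<sigma> = (\<lambda>m. volterra g (h m))"
  have h: "h m \<in> weighted_unit_ball \<alpha>" for m
    unfolding h_def by (rule power_mult_in_weighted_unit_ball[OF f])
  let ?I = "volterra g ` weighted_unit_ball \<alpha>"
  have IH: "?I \<subseteq> Hinf" using T unfolding compact_operator_def by blast
  have "range \<sigma> \<subseteq> ?I" using h unfolding \<sigma>_def by blast
  also have "?I \<subseteq> H.mtopology closure_of ?I" using IH by (intro closure_of_subset) simp
  finally have "range \<sigma> \<subseteq> H.mtopology closure_of ?I" .
  moreover have "compactin H.mtopology (H.mtopology closure_of ?I)"
    using T unfolding compact_operator_def norm_topology_def by blast
  ultimately obtain l r where r: "strict_mono r" and lim: "limitin H.mtopology (\<sigma> \<circ> r) l sequentially"
    unfolding H.compactin_sequentially by (elim conjE allE[of _ \<sigma>] impE exE) assumption+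
  have l: "l \<in> Hinf" and dist0: "(\<lambda>n. norm_dist Hinf Hinf_norm (\<sigma> (r n)) l) \<longlonglongrightarrow> 0"
    using lim unfolding H.limitin_metric_dist_null by (simp_all add: o_def)
  have \<sigma>H: "\<sigma> m \<in> Hinf" for m using IH h unfolding \<sigma>_def by blast
  have l0: "l z = 0" if z: "z \<in> \<D>" for z
  proof -
    have s: "0 \<le> norm z" "norm z < 1" using z by auto
    have sub: "cball (0::complex) (norm z) \<subseteq> \<D>" using s by auto
    obtain L where L: "\<forall>f a. f \<in> hol_disc \<and> (\<forall>w\<in>cball 0 (norm z). norm (f w) \<le> a) \<longrightarrow>
        (\<forall>w\<in>cball 0 (norm z). norm (volterra g f w) \<le> a * L)"
      using volterra_small_on_cball[OF g s] ..
    obtain B where B: "\<forall>f\<in>weighted_unit_ball \<alpha>. \<forall>w\<in>cball 0 (norm z). norm (f w) \<le> B"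
      using weighted_unit_ball_locally_bounded[OF compact_cball sub] ..
    have "norm (\<sigma> m z) \<le> norm z ^ m * B * L" for m
    proof -
      have "norm (h m w) \<le> norm z ^ m * B" if w: "w \<in> cball 0 (norm z)" for w
      proof -
        have "norm w \<le> norm z" using w by simp
        moreover have "norm (f m w) \<le> B" using B f w by blast
        ultimately show ?thesis unfolding h_def norm_mult norm_power
          by (intro mult_mono power_mono) auto
      qed
      moreover have "h m \<in> hol_disc" using h unfolding weighted_unit_ball_iff by blast
      moreover have "z \<in> cball 0 (norm z)" by simp
      ultimately show ?thesis using L[rule_format, of "h m" "norm z ^ m * B" z] unfolding \<sigma>_def by simp
    qed
    moreover have "(\<lambda>m. norm z ^ m * B * L) \<longlonglongrightarrow> 0"
      using tendsto_mult_left_zero[OF tendsto_mult_left_zero[OF LIMSEQ_realpow_zero[OF s]]] .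
    ultimately have "(\<lambda>m. \<sigma> m z) \<longlonglongrightarrow> 0" by (rule Lim_null_comparison[OF always_eventually[OF allI]])
    from LIMSEQ_subseq_LIMSEQ[OF this r]
    have 1: "(\<lambda>n. \<sigma> (r n) z) \<longlonglongrightarrow> 0" unfolding o_def .
    have "(\<lambda>n. \<sigma> (r n) z - l z) \<longlonglongrightarrow> 0"
      by (rule Lim_null_comparison[OF always_eventually[OF allI] dist0])
        (rule norm_dist_Hinf_upper[OF \<sigma>H l z])
    then have "(\<lambda>n. \<sigma> (r n) z) \<longlonglongrightarrow> l z" by (rule LIM_zero_cancel)
    then show ?thesis using 1 by (rule LIMSEQ_unique)
  qed
  have "\<epsilon> \<le> norm_dist Hinf Hinf_norm (\<sigma> (r n)) l" for n
    using norm_dist_Hinf_upper[OF \<sigma>H[of "r n"] l \<zeta>[of "r n"]] l0[OF \<zeta>[of "r n"]] big[of "r n"]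
    by (simp add: \<sigma>_def h_def)
  then have "\<epsilon> \<le> 0" by (intro LIMSEQ_le_const[OF dist0]) auto
  then show False using \<epsilon> by simp
qed

text \<open>
  The exponent \<open>m\<close> is fixed first; then \<open>t\<close> is taken so close to 1 that \<open>t ^ m > 1 / 2\<close>.
\<close>
lemma compact_volterra_imp_radial_tails:
  assumes g: "g holomorphic_on \<D>" and inj: "inj_on g \<D>" and \<alpha>: "0 \<le> \<alpha>" and \<epsilon>: "\<epsilon> > 0"
    and T: "compact_operator (Hinf_weighted \<alpha>) (Hinf_weighted_norm \<alpha>) Hinf Hinf_norm (volterra g)"
  shows "\<exists>t\<in>{0<..<1}. \<forall>\<theta>. (\<integral>\<^sup>+ r\<in>{t<..<1}. ennreal (radial_density g \<alpha> \<theta> r) \<partial>lborel) \<le> ennreal \<epsilon>"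
proof -
  obtain C where C: "C > 0" and tail: "\<forall>m \<delta> \<theta> t. 0 < t \<and> t < 1 \<and>
    (\<forall>f\<in>weighted_unit_ball \<alpha>. \<forall>z\<in>\<D>. norm (volterra g (\<lambda>z. z ^ m * f z) z) \<le> \<delta>) \<longrightarrow>
    (\<integral>\<^sup>+ r\<in>{t<..<1}. ennreal (radial_density g \<alpha> \<theta> r) \<partial>lborel) \<le> ennreal (C * \<delta> / t ^ m)"
    using radial_tail_le_volterra[OF g inj \<alpha>] by (elim exE conjE)
  define \<delta> where "\<delta> = \<epsilon> / (2 * C)"
  have \<delta>: "\<delta> > 0" using \<epsilon> C by (simp add: \<delta>_def)
  obtain m where m: "\<forall>f\<in>weighted_unit_ball \<alpha>. \<forall>z\<in>\<D>. norm (volterra g (\<lambda>z. z ^ m * f z) z) \<le> \<delta>"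
    using compact_volterra_small_on_high_powers[OF g \<delta> T] ..
  have "((\<lambda>t::real. t ^ m) \<longlongrightarrow> 1 ^ m) (at_left 1)" by (intro tendsto_intros)
  then have "eventually (\<lambda>t::real. t ^ m > 1 / 2) (at_left 1)" by (rule order_tendstoD) simp
  moreover have "eventually (\<lambda>t::real. t \<in> {0<..<1}) (at_left 1)"
    by (rule eventually_at_leftI[of 0]) auto
  ultimately have "eventually (\<lambda>t::real. t ^ m > 1 / 2 \<and> t \<in> {0<..<1}) (at_left 1)"
    by (rule eventually_conj)
  then obtain t :: real where t: "t ^ m > 1 / 2" "t \<in> {0<..<1}"
    using eventually_happens[of _ "at_left (1::real)"] trivial_limit_at_left_real by blast
  have "C * \<delta> / t ^ m \<le> C * \<delta> / (1 / 2)" using t C \<delta> by (intro divide_left_mono) auto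
  also have "\<dots> = \<epsilon>" using C by (simp add: \<delta>_def)
  finally have le: "ennreal (C * \<delta> / t ^ m) \<le> ennreal \<epsilon>" by (rule ennreal_leI)
  have "(\<integral>\<^sup>+ r\<in>{t<..<1}. ennreal (radial_density g \<alpha> \<theta> r) \<partial>lborel) \<le> ennreal \<epsilon>" for \<theta>
    using tail[rule_format, of t m \<delta> \<theta>] t(2) m le by (auto intro: order_trans)
  then show ?thesis using t(2) by blast
qed

section \<open>Small radial tails force compactness\<close>

lemma radial_tails_imp_volterra_in_Hinf:
  assumes g: "g holomorphic_on \<D>" and f: "f \<in> Hinf_weighted \<alpha>"
    and t: "0 < t" "t < 1"
    and tail: "\<And>\<theta>. \<theta> \<in> {0..<2 * pi} \<Longrightarrow>
      (\<integral>\<^sup>+ r\<in>{t<..<1}. ennreal (radial_density g \<alpha> \<theta> r) \<partial>lborel) \<le> ennreal 1"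
  shows "volterra g f \<in> Hinf"
proof -
  have fh: "f \<in> hol_disc" and "bdd_above ((\<lambda>z. std_weight \<alpha> z * norm (f z)) ` \<D>)"
    using f by (simp_all add: Hinf_weighted_def)
  then obtain K where K: "\<And>z. z \<in> \<D> \<Longrightarrow> std_weight \<alpha> z * norm (f z) \<le> K"
    unfolding bdd_above_def by fast
  have "0 \<le> std_weight \<alpha> 0 * norm (f 0)" by (simp add: std_weight_def)
  also have "\<dots> \<le> K" by (rule K) simp
  finally have K0: "0 \<le> K" .
  define s where "s = (1 + t) / 2"
  have s: "t < s" "s < 1" using t by (simp_all add: s_def)
  have Th: "volterra g f \<in> hol_disc" by (rule volterra_in_hol_disc[OF g fh])
  have "volterra g f holomorphic_on \<D>" using Th by (simp add: hol_disc_def)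
  then have "continuous_on (cball 0 s) (volterra g f)"
    by (rule continuous_on_subset[OF holomorphic_on_imp_continuous_on]) (use s in auto)
  then have "compact (volterra g f ` cball 0 s)" by (rule compact_continuous_image) simp
  from compact_imp_bounded[OF this] obtain \<delta> where "\<forall>x\<in>volterra g f ` cball 0 s. norm x \<le> \<delta>"
    unfolding bounded_iff ..
  then have \<delta>: "norm (volterra g f z) \<le> \<delta>" if "z \<in> cball 0 s" for z using that by blast
  have "norm (volterra g f z) \<le> \<delta> + K * 1" if "z \<in> \<D>" for z
    using t by (intro volterra_bound_from_radial_tails[OF g fh K K0 _ s tail _ \<delta> that]) auto
  then have "bounded (volterra g f ` \<D>)" unfolding bounded_iff by blast
  then show ?thesis using Th by (simp add: Hinf_def)
qed

text \<open>
  The image of the unit ball is itself compact. By Montel's theorem a sequence in the unit ball has a subsequence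
  that converges locally uniformly, and the limit is again in the unit ball. The images converge uniformly on a
  disc of radius \<open>s\<close> because the functions do, and outside of it because the difference of two elements of the unit ball
  has weighted norm at most 2 and the radial tails are small.
\<close>
lemma radial_tails_imp_compact_volterra:
  assumes g: "g holomorphic_on \<D>"
    and tails: "\<And>\<epsilon>. \<epsilon> > 0 \<Longrightarrow> \<exists>t\<in>{0<..<1}. \<forall>\<theta>\<in>{0..<2 * pi}.
      (\<integral>\<^sup>+ r\<in>{t<..<1}. ennreal (radial_density g \<alpha> \<theta> r) \<partial>lborel) \<le> ennreal \<epsilon>"
  shows "compact_operator (Hinf_weighted \<alpha>) (Hinf_weighted_norm \<alpha>) Hinf Hinf_norm (volterra g)"
proof -
  interpret H: Metric_space Hinf "norm_dist Hinf Hinf_norm" by (rule Metric_space_Hinf)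
  let ?T = "volterra g" and ?U = "weighted_unit_ball \<alpha>"
  have TH: "?T f \<in> Hinf" if "f \<in> Hinf_weighted \<alpha>" for f
  proof -
    obtain t where "t \<in> {0<..<1}" "\<forall>\<theta>\<in>{0..<2 * pi}.
      (\<integral>\<^sup>+ r\<in>{t<..<1}. ennreal (radial_density g \<alpha> \<theta> r) \<partial>lborel) \<le> ennreal 1"
      using tails[of 1] by auto
    then show ?thesis using radial_tails_imp_volterra_in_Hinf[OF g that, of t] by auto
  qed
  have U_hol: "f \<in> hol_disc" if "f \<in> ?U" for f using that unfolding weighted_unit_ball_iff by blast
  have seq: "\<exists>l r. l \<in> ?T ` ?U \<and> strict_mono r \<and> limitin H.mtopology (\<sigma> \<circ> r) l sequentially"
    if "range \<sigma> \<subseteq> ?T ` ?U" for \<sigma> :: "nat \<Rightarrow> complex \<Rightarrow> complex"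
  proof -
    have "\<forall>n. \<exists>f. f \<in> ?U \<and> \<sigma> n = ?T f" using that by blast
    then obtain F where F: "\<And>n. F n \<in> ?U" "\<And>n. \<sigma> n = ?T (F n)" by metis
    have hol: "f holomorphic_on \<D>" if "f \<in> ?U" for f using U_hol[OF that] by (simp add: hol_disc_def)
    have lb: "\<exists>B. \<forall>f\<in>?U. \<forall>z\<in>K. norm (f z) \<le> B" if "compact K" "K \<subseteq> \<D>" for K
      using that by (rule weighted_unit_ball_locally_bounded)
    have rF: "range F \<subseteq> ?U" using F(1) by blast
    show ?thesis
    proof (rule Montel[OF open_ball hol lb rF])
      fix f0 and r :: "nat \<Rightarrow> nat"
      assume f0: "f0 holomorphic_on \<D>" and r: "strict_mono r"
        and pw: "\<And>z. z \<in> \<D> \<Longrightarrow> (\<lambda>n. F (r n) z) \<longlonglongrightarrow> f0 z"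
        and unif: "\<And>K. compact K \<Longrightarrow> K \<subseteq> \<D> \<Longrightarrow> uniform_limit K (F \<circ> r) f0 sequentially"
      define f where "f = (\<lambda>z. if z \<in> \<D> then f0 z else 0)"
      have "f holomorphic_on \<D>" using f0 by (rule holomorphic_transform) (simp add: f_def)
      then have fh: "f \<in> hol_disc" by (simp add: hol_disc_def f_def)
      have fU: "f \<in> ?U"
        unfolding weighted_unit_ball_iff
      proof (intro conjI fh ballI)
        fix z assume z: "z \<in> \<D>"
        have "(\<lambda>n. std_weight \<alpha> z * norm (F (r n) z)) \<longlonglongrightarrow> std_weight \<alpha> z * norm (f0 z)"
          by (intro tendsto_intros pw z)
        moreover have "std_weight \<alpha> z * norm (F (r n) z) \<le> 1" for n
          using F(1)[of "r n"] z unfolding weighted_unit_ball_iff by blast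
        ultimately have "std_weight \<alpha> z * norm (f0 z) \<le> 1" by (intro LIMSEQ_le_const2) auto
        then show "std_weight \<alpha> z * norm (f z) \<le> 1" using z by (simp add: f_def)
      qed
      have conv: "\<forall>\<^sub>F n in sequentially. norm_dist Hinf Hinf_norm (?T (F (r n))) (?T f) < \<epsilon>"
        if \<epsilon>: "\<epsilon> > 0" for \<epsilon>
      proof -
        \<comment> \<open>The error \<open>\<epsilon>\<close> is shared out as \<open>\<epsilon> / 3\<close> on the inner disc and \<open>2 * (\<epsilon> / 6)\<close> from the tails; the
          sum is still less than \<open>\<epsilon>\<close>.\<close>
        have "\<epsilon> / 6 > 0" using \<epsilon> by simp
        then obtain t where t: "t \<in> {0<..<1}" and tail: "\<forall>\<theta>\<in>{0..<2 * pi}.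
            (\<integral>\<^sup>+ r\<in>{t<..<1}. ennreal (radial_density g \<alpha> \<theta> r) \<partial>lborel) \<le> ennreal (\<epsilon> / 6)"
          using tails by blast
        define s where "s = (1 + t) / 2"
        have s: "0 \<le> t" "t < s" "0 \<le> s" "s < 1" using t by (simp_all add: s_def)
        have sub: "cball (0::complex) s \<subseteq> \<D>" using s by auto
        obtain L where L: "\<forall>f a. f \<in> hol_disc \<and> (\<forall>w\<in>cball 0 s. norm (f w) \<le> a) \<longrightarrow>
            (\<forall>z\<in>cball 0 s. norm (volterra g f z) \<le> a * L)"
          using volterra_small_on_cball[OF g s(3,4)] ..
        define a where "a = \<epsilon> / 3 / (\<bar>L\<bar> + 1)"
        have L1: "\<bar>L\<bar> + 1 > 0" by simp
        have a: "a > 0" unfolding a_def using \<epsilon> L1 by (intro divide_pos_pos) auto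
        have "a * L \<le> a * (\<bar>L\<bar> + 1)" using a by (intro mult_left_mono) auto
        also have "\<dots> = \<epsilon> / 3" 
        proof -
          have "x / c * c = x" if "c > 0" for x c :: real using that by simp
          then show ?thesis unfolding a_def using L1 by blast
        qed
        finally have aL: "a * L \<le> \<epsilon> / 3" .
        have "\<forall>\<^sub>F n in sequentially. \<forall>w\<in>cball 0 s. dist ((F \<circ> r) n w) (f0 w) < a"
          using uniform_limitD[OF unif[OF compact_cball sub] a] .
        then show ?thesis
        proof eventually_elim
          case (elim n)
          define k where "k = (\<lambda>z. F (r n) z - f z)"
          have kh: "k \<in> hol_disc"
            using U_hol[OF F(1)] fh unfolding k_def hol_disc_def by (auto intro: holomorphic_intros)
          have ks: "norm (k w) \<le> a" if "w \<in> cball 0 s" for w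
          proof -
            have "w \<in> \<D>" using sub that by blast
            then show ?thesis using elim[rule_format, OF that] by (simp add: k_def f_def dist_norm)
          qed
          have kw: "std_weight \<alpha> z * norm (k z) \<le> 2" if z: "z \<in> \<D>" for z
          proof -
            have "std_weight \<alpha> z * norm (k z) \<le> std_weight \<alpha> z * (norm (F (r n) z) + norm (f z))"
              unfolding k_def using std_weight_pos[OF z, of \<alpha>]
              by (intro mult_left_mono norm_triangle_ineq4) auto
            moreover have "std_weight \<alpha> z * norm (F (r n) z) \<le> 1" "std_weight \<alpha> z * norm (f z) \<le> 1"
              using F(1)[of "r n"] fU z unfolding weighted_unit_ball_iff by blast+
            ultimately show ?thesis unfolding distrib_left by linarith
          qed
          have "norm (?T k z) \<le> \<epsilon> / 3" if "z \<in> cball 0 s" for z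
            using L[rule_format, of k a z] kh ks that aL by (meson order_trans)
          then have "norm (?T k z) \<le> \<epsilon> / 3 + 2 * (\<epsilon> / 6)" if "z \<in> \<D>" for z
            using \<epsilon> tail s that by (intro volterra_bound_from_radial_tails[OF g kh kw, of t s]) auto
          then have "norm (?T (F (r n)) z - ?T f z) \<le> \<epsilon> / 3 + 2 * (\<epsilon> / 6)" if "z \<in> \<D>" for z
            
            using that unfolding k_def volterra_diff[OF g U_hol[OF F(1)[of "r n"]] fh] by simp
          then have "Hinf_norm (\<lambda>z. ?T (F (r n)) z - ?T f z) \<le> \<epsilon> / 3 + 2 * (\<epsilon> / 6)"
            by (rule Hinf_norm_least)
          also have "\<dots> < \<epsilon>" using \<epsilon> by simp
          finally show ?case using F(1)[of "r n"] fU TH by (simp add: norm_dist_def)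
        qed
      qed
      have "limitin H.mtopology (\<sigma> \<circ> r) (?T f) sequentially"
        unfolding H.limitin_metric
      proof (intro conjI allI impI)
        show "?T f \<in> Hinf" using fU TH by blast
        fix \<epsilon> :: real assume "\<epsilon> > 0"
        from conv[OF this]
        show "\<forall>\<^sub>F n in sequentially. (\<sigma> \<circ> r) n \<in> Hinf \<and> norm_dist Hinf Hinf_norm ((\<sigma> \<circ> r) n) (?T f) < \<epsilon>"
        proof eventually_elim
          case (elim n)
          then show ?case using F(1)[of "r n"] TH by (simp add: F(2))
        qed
      qed
      then show ?thesis using fU r by blast
    qed
  qed
  have "compactin H.mtopology (?T ` ?U)"
    unfolding H.compactin_sequentially using TH seq by blast
  moreover from this have "closedin H.mtopology (?T ` ?U)"
    by (rule compactin_imp_closedin[OF H.Hausdorff_space_mtopology])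
  ultimately have "compactin H.mtopology (H.mtopology closure_of (?T ` ?U))"
    by (simp add: closure_of_closedin)
  moreover have "linear_map_on (Hinf_weighted \<alpha>) ?T"
    by (rule linear_map_on_volterra[OF g]) (auto simp: Hinf_weighted_def)
  ultimately show ?thesis
    unfolding compact_operator_def norm_topology_def using TH by blast
qed

section \<open>The characterisation\<close>

lemma tendsto_0_at_left_antimono_iff:
  fixes S :: "real \<Rightarrow> ennreal"
  assumes anti: "\<And>t u. t \<le> u \<Longrightarrow> S u \<le> S t"
  shows "(S \<longlongrightarrow> 0) (at_left 1) \<longleftrightarrow> (\<forall>\<epsilon>>0. \<exists>t\<in>{0<..<1}. S t \<le> ennreal \<epsilon>)"
proof (intro iffI allI impI)
  fix \<epsilon> :: real assume lim: "(S \<longlongrightarrow> 0) (at_left 1)" and \<epsilon>: "\<epsilon> > 0"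
  have "eventually (\<lambda>t. S t < ennreal \<epsilon>) (at_left 1)"
    using order_tendstoD(2)[OF lim] \<epsilon> by simp
  moreover have "eventually (\<lambda>t::real. t \<in> {0<..<1}) (at_left 1)"
    by (rule eventually_at_leftI[of 0]) auto
  ultimately have "eventually (\<lambda>t. S t < ennreal \<epsilon> \<and> t \<in> {0<..<1}) (at_left 1)" by (rule eventually_conj)
  then obtain t where "S t < ennreal \<epsilon>" "t \<in> {0<..<1}"
    using eventually_happens[of _ "at_left (1::real)"] trivial_limit_at_left_real by blast
  then show "\<exists>t\<in>{0<..<1}. S t \<le> ennreal \<epsilon>" by (intro bexI[of _ t]) auto
next
  assume small: "\<forall>\<epsilon>>0. \<exists>t\<in>{0<..<1}. S t \<le> ennreal \<epsilon>"
  show "(S \<longlongrightarrow> 0) (at_left 1)"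
  proof (rule order_tendstoI)
    fix a :: ennreal assume "0 < a"
    then obtain b where b: "0 < b" "b < a" using dense by blast
    then obtain \<epsilon> where \<epsilon>: "b = ennreal \<epsilon>" "0 \<le> \<epsilon>" by (cases b) auto
    then have "\<epsilon> > 0" using b by simp
    then obtain t where t: "t \<in> {0<..<1}" "S t \<le> ennreal \<epsilon>" using small by blast
    show "eventually (\<lambda>u. S u < a) (at_left 1)"
    proof (rule eventually_at_leftI[of t])
      show "S u < a" if "u \<in> {t<..<1}" for u
        using anti[of t u] t(2) b \<epsilon> that by (simp add: le_less_trans)
    qed (use t in simp)
  qed simp
qed

theorem theorem2p3:
  fixes g :: "complex \<Rightarrow> complex" and \<alpha> :: real
  assumes "g holomorphic_on \<D>" and "inj_on g \<D>"
    and "0 \<le> \<alpha>" and "\<alpha> < 1"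
  shows "compact_operator (Hinf_weighted \<alpha>) (Hinf_weighted_norm \<alpha>) Hinf Hinf_norm (volterra g)
    \<longleftrightarrow>
    ((\<lambda>t. SUP \<theta>\<in>{0..<2 * pi}.
        \<integral>\<^sup>+ r\<in>{t<..<1}. ennreal (norm (deriv g (of_real r * exp (\<i> * of_real \<theta>)))
                                / (1 - r\<^sup>2) powr \<alpha>) \<partial>lborel)
      \<longlongrightarrow> 0) (at_left (1::real))"
proof -
  define S where "S = (\<lambda>t. SUP \<theta>\<in>{0..<2 * pi}.
    \<integral>\<^sup>+ r\<in>{t<..<1}. ennreal (radial_density g \<alpha> \<theta> r) \<partial>lborel)"
  have anti: "S u \<le> S t" if "t \<le> u" for t u
    unfolding S_def using that
    by (intro SUP_mono bexI nn_integral_mono mult_left_mono) (auto simp: indicator_def)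
  have S_le: "S t \<le> c \<longleftrightarrow> (\<forall>\<theta>\<in>{0..<2 * pi}.
      (\<integral>\<^sup>+ r\<in>{t<..<1}. ennreal (radial_density g \<alpha> \<theta> r) \<partial>lborel) \<le> c)" for t c
    unfolding S_def by (rule SUP_le_iff)
  have "compact_operator (Hinf_weighted \<alpha>) (Hinf_weighted_norm \<alpha>) Hinf Hinf_norm (volterra g)
    \<longleftrightarrow> (\<forall>\<epsilon>>0. \<exists>t\<in>{0<..<1}. S t \<le> ennreal \<epsilon>)"
    unfolding S_le
  proof (intro iffI allI impI)
    fix \<epsilon> :: real
    assume "compact_operator (Hinf_weighted \<alpha>) (Hinf_weighted_norm \<alpha>) Hinf Hinf_norm (volterra g)" "\<epsilon> > 0"
    from compact_volterra_imp_radial_tails[OF assms(1-3) this(2,1)]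
    show "\<exists>t\<in>{0<..<1}. \<forall>\<theta>\<in>{0..<2 * pi}.
      (\<integral>\<^sup>+ r\<in>{t<..<1}. ennreal (radial_density g \<alpha> \<theta> r) \<partial>lborel) \<le> ennreal \<epsilon>" by blast
  next
    assume "\<forall>\<epsilon>>0. \<exists>t\<in>{0<..<1}. \<forall>\<theta>\<in>{0..<2 * pi}.
      (\<integral>\<^sup>+ r\<in>{t<..<1}. ennreal (radial_density g \<alpha> \<theta> r) \<partial>lborel) \<le> ennreal \<epsilon>"
    then show "compact_operator (Hinf_weighted \<alpha>) (Hinf_weighted_norm \<alpha>) Hinf Hinf_norm (volterra g)"
      by (intro radial_tails_imp_compact_volterra[OF assms(1)]) blast
  qed
  also have "\<dots> \<longleftrightarrow> (S \<longlongrightarrow> 0) (at_left 1)"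
    by (rule tendsto_0_at_left_antimono_iff[OF anti, symmetric])
  finally show ?thesis unfolding S_def radial_density_def .
qed

end
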